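(* Let $\mathcal A=A(V,R)=T(V)/(R)$ be a quadratic algebra with geometric data $(E,\sigma)$, let $C$ be a component of $E\times E$ globally invariant under $\tilde\sigma(Z,Z')=(\sigma(Z),\sigma^{-1}(Z'))$, and let $Q\in S^2(V)$ be central and not identically zero on $C$. Let $C_Q$ be the generalised cross-product algebra defined in the context. (i) The following equality defines a homomorphism $\rho:\mathcal A\to C_Q$: $$\sqrt2\,\rho(Y)=\frac{Y(Z)}{L(Z)}\,W_L+W'_{L'}\,\frac{Y(Z')}{L'(Z')},\qquad\forall\,Y\in V.$$ (ii) If $\sigma^4\neq 1$, then $\rho(Q)=1$, where $Q$ is viewed as an element of $T(V)/(R)$.
   Context: $V$ is a finite-dimensional complex vector space, $R\subset V\otimes V$ a subspace, $(R)$ the two-sided ideal of the tensor algebra $T(V)$ it generates. Elements of $V$ are linear forms on $V^*$ and elements of $V\otimes V$ (in particular of $R$ and of $S^2(V)$) are bilinear forms on $V^*$. Geometric data: $\Gamma\subset P(V^* )\times P(V^* )$ is the set of pairs $(Z,Z')$ with $\omega(Z,Z')=0$ for all $\omega\in R$. It is assumed that both projections of $\Gamma$ equal the same subvariety $E\subset P(V^* )$ and that $\Gamma$ is the graph $\{(Z,\sigma(Z))\}$ of an automorphism $\sigma$ of $E$. Central: $Q\in S^2(V)$ is central on $C$ iff for all $(Z,Z')\in C$ and $\omega\in R$, $$\omega(Z,Z')\,Q(\sigma(Z'),\sigma^{-1}(Z))+Q(Z,Z')\,\omega(\sigma(Z'),\sigma^{-1}(Z))=0.$$ Definition of $C_Q$: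 let $L,L'\in V$ be such that $L(Z)L'(Z')$ does not vanish identically on $C$. $C_Q$ is generated by the ring of meromorphic functions on $C$ and two generators $W_L$, $W'_{L'}$ subject to $W_Lf=(f\circ\tilde\sigma)W_L$, $W'_{L'}f=(f\circ\tilde\sigma^{-1})W'_{L'}$ for all meromorphic functions $f$ on $C$, and $$W_LW'_{L'}=\pi(Z,Z'),\qquad W'_{L'}W_L=\pi(\sigma^{-1}(Z),\sigma(Z')),\qquad \pi(Z,Z')=\frac{L(Z)L'(Z')}{Q(Z,Z')}.$$ The algebra does not depend on the choice of $L,L'$ when different choices are related by $W_{L_2}=\frac{L_2(Z)}{L_1(Z)}W_{L_1}$ and $W'_{L'_2}=W'_{L'_1}\frac{L'_2(Z')}{L'_1(Z')}$.
   Formalization: In (ii), "σ⁴≠1" is required on each of the two factors of C (not just on E), and either the two factors of C coincide or Q is central on all of E×E; as literally stated (ii) fails for reducible E, e.g. C={(e,e)} with e a fixed point of σ. *)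

theory Defs
  imports "HOL-Analysis.Analysis" "HOL-Algebra.QuotRing"
begin

text \<open>
  V is \<open>complex^'n\<close> and \<open>V\<^sup>*\<close> is \<open>complex^'n\<close> with the dual coordinates, paired
  by \<open>\<Sum>i. Y$i * Z$i\<close> (bilinear, no conjugation).  \<open>V \<otimes> V\<close> is \<open>complex^('n\<times>'n)\<close>.
  The type \<open>'n proj\<close> is \<open>P(V\<^sup>*)\<close>.
\<close>

definition proj_rel :: "complex^'n \<Rightarrow> complex^'n \<Rightarrow> bool" where
  "proj_rel x y \<longleftrightarrow> x \<noteq> 0 \<and> (\<exists>c. c \<noteq> 0 \<and> y = c *s x)"

lemma part_equivp_proj_rel: "part_equivp (proj_rel :: complex^'n \<Rightarrow> complex^'n \<Rightarrow> bool)"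
proof (rule part_equivpI)
  show "\<exists>x :: complex^'n. proj_rel x x"
    by (rule exI[of _ "vec 1"]) (auto simp: proj_rel_def vec_eq_iff intro!: exI[of _ 1])
  show "symp (proj_rel :: complex^'n \<Rightarrow> complex^'n \<Rightarrow> bool)"
  proof (rule sympI)
    fix x y :: "complex^'n"
    assume "proj_rel x y"
    then obtain c where c: "x \<noteq> 0" "c \<noteq> 0" "y = c *s x"
      by (auto simp: proj_rel_def)
    then have "x = inverse c *s y" "y \<noteq> 0"
      by (auto simp: vector_smult_assoc vec.scale_eq_0_iff)
    then show "proj_rel y x"
      using c(2) unfolding proj_rel_def by (metis nonzero_imp_inverse_nonzero)
  qed
  show "transp (proj_rel :: complex^'n \<Rightarrow> complex^'n \<Rightarrow> bool)"
    by (rule transpI) (auto simp: proj_rel_def vector_smult_assoc intro: mult_eq_0_iff[THEN iffD1])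
qed

quotient_type 'n proj = "complex^'n" / partial: proj_rel
  by (rule part_equivp_proj_rel)

text \<open>
  Forms are evaluated at the chosen representatives \<open>rep_proj Z\<close>.  Only vanishing conditions
  on (bi)homogeneous expressions and ratios of equal (bi)degree are used below; these do
  not depend on the choice.
\<close>

definition lin :: "complex^'n \<Rightarrow> 'n proj \<Rightarrow> complex" where
  "lin Y Z = (\<Sum>i\<in>UNIV. Y $ i * rep_proj Z $ i)"

definition bil :: "complex^('n::finite \<times> 'n) \<Rightarrow> 'n proj \<Rightarrow> 'n proj \<Rightarrow> complex" where
  "bil B Z Z' = (\<Sum>i\<in>UNIV. \<Sum>j\<in>UNIV. B $ (i, j) * rep_proj Z $ i * rep_proj Z' $ j)"

definition symmetric_tensors :: "(complex^('n::finite \<times> 'n)) set" where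
  "symmetric_tensors = {B. \<forall>i j. B $ (i, j) = B $ (j, i)}"

inductive_set function_algebra :: "('a \<Rightarrow> complex) set \<Rightarrow> ('a \<Rightarrow> complex) set"
  for X :: "('a \<Rightarrow> complex) set" where
  gen: "f \<in> X \<Longrightarrow> f \<in> function_algebra X"
| const: "(\<lambda>_. c) \<in> function_algebra X"
| add: "\<lbrakk>f \<in> function_algebra X; g \<in> function_algebra X\<rbrakk>
    \<Longrightarrow> (\<lambda>x. f x + g x) \<in> function_algebra X"
| mult: "\<lbrakk>f \<in> function_algebra X; g \<in> function_algebra X\<rbrakk>
    \<Longrightarrow> (\<lambda>x. f x * g x) \<in> function_algebra X"

definition homogeneous :: "nat \<Rightarrow> (complex^'n \<Rightarrow> complex) \<Rightarrow> bool" where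
  "homogeneous d p \<longleftrightarrow> p \<in> function_algebra (range (\<lambda>i z. z $ i)) \<and>
     (\<forall>c z. p (c *s z) = c ^ d * p z)"

definition bihomogeneous ::
  "nat \<Rightarrow> nat \<Rightarrow> ((complex^'n) \<times> (complex^'n) \<Rightarrow> complex) \<Rightarrow> bool" where
  "bihomogeneous d e p \<longleftrightarrow>
     p \<in> function_algebra (range (\<lambda>i z. fst z $ i) \<union> range (\<lambda>i z. snd z $ i)) \<and>
     (\<forall>a b z z'. p (a *s z, b *s z') = a ^ d * b ^ e * p (z, z'))"

text \<open>The basic open sets are closed under intersection, so the closed sets are exactly the
  common zero sets of families of (bi)homogeneous polynomials.\<close>

definition zariski :: "('n::finite) proj topology" where
  "zariski = topology_generated_by
     {{Z. p (rep_proj Z) \<noteq> 0} | p. \<exists>d. homogeneous d p}"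

abbreviation rep2 :: "'n proj \<times> 'n proj \<Rightarrow> (complex^'n) \<times> (complex^'n)" where
  "rep2 p \<equiv> (rep_proj (fst p), rep_proj (snd p))"

definition zariski2 :: "(('n::finite) proj \<times> 'n proj) topology" where
  "zariski2 = topology_generated_by
     {{x. p (rep2 x) \<noteq> 0} | p. \<exists>d e. bihomogeneous d e p}"

definition irreducible_in :: "'a topology \<Rightarrow> 'a set \<Rightarrow> bool" where
  "irreducible_in T S \<longleftrightarrow> S \<subseteq> topspace T \<and> S \<noteq> {} \<and>
     (\<forall>A B. closedin T A \<and> closedin T B \<and> S \<subseteq> A \<union> B \<longrightarrow> S \<subseteq> A \<or> S \<subseteq> B)"

definition irreducible_component :: "'a topology \<Rightarrow> 'a set \<Rightarrow> 'a set \<Rightarrow> bool" where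
  "irreducible_component T X C \<longleftrightarrow> irreducible_in T C \<and> C \<subseteq> X \<and>
     (\<forall>D. irreducible_in T D \<and> C \<subseteq> D \<and> D \<subseteq> X \<longrightarrow> D = C)"

definition regular_map_on :: "('n::finite) proj set \<Rightarrow> ('n proj \<Rightarrow> 'n proj) \<Rightarrow> bool" where
  "regular_map_on E s \<longleftrightarrow> (\<forall>Z\<in>E. \<exists>U d F. openin zariski U \<and> Z \<in> U \<and>
     (\<forall>i. homogeneous d (\<lambda>z. F z $ i)) \<and>
     (\<forall>X\<in>U \<inter> E. F (rep_proj X) \<noteq> 0 \<and> s X = abs_proj (F (rep_proj X))))"

definition variety_automorphism :: "('n::finite) proj set \<Rightarrow> ('n proj \<Rightarrow> 'n proj) \<Rightarrow> bool" where
  "variety_automorphism E s \<longleftrightarrow>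
     bij_betw s E E \<and> regular_map_on E s \<and> regular_map_on E (inv_into E s)"

definition Gamma :: "(complex^('n::finite \<times> 'n)) set \<Rightarrow> ('n proj \<times> 'n proj) set" where
  "Gamma R = {(Z, Z'). \<forall>\<omega>\<in>R. bil \<omega> Z Z' = 0}"

definition geometric_data ::
  "(complex^('n::finite \<times> 'n)) set \<Rightarrow> 'n proj set \<Rightarrow> ('n proj \<Rightarrow> 'n proj) \<Rightarrow> bool" where
  "geometric_data R E \<sigma> \<longleftrightarrow>
     fst ` Gamma R = E \<and> snd ` Gamma R = E \<and> closedin zariski E \<and>
     variety_automorphism E \<sigma> \<and> Gamma R = {(Z, \<sigma> Z) | Z. Z \<in> E}"

definition sigma_tilde ::
  "('n::finite) proj set \<Rightarrow> ('n proj \<Rightarrow> 'n proj) \<Rightarrow> 'n proj \<times> 'n proj \<Rightarrow> 'n proj \<times> 'n proj" where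
  "sigma_tilde E \<sigma> = (\<lambda>(Z, Z'). (\<sigma> Z, inv_into E \<sigma> Z'))"

definition sigma_tilde_inv ::
  "('n::finite) proj set \<Rightarrow> ('n proj \<Rightarrow> 'n proj) \<Rightarrow> 'n proj \<times> 'n proj \<Rightarrow> 'n proj \<times> 'n proj" where
  "sigma_tilde_inv E \<sigma> = (\<lambda>(Z, Z'). (inv_into E \<sigma> Z, \<sigma> Z'))"

definition central_on ::
  "(complex^('n::finite \<times> 'n)) set \<Rightarrow> 'n proj set \<Rightarrow> ('n proj \<Rightarrow> 'n proj) \<Rightarrow>
   complex^('n::finite \<times> 'n) \<Rightarrow> ('n proj \<times> 'n proj) set \<Rightarrow> bool" where
  "central_on R E \<sigma> Q C \<longleftrightarrow> (\<forall>(Z, Z')\<in>C. \<forall>\<omega>\<in>R.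
     bil \<omega> Z Z' * bil Q (\<sigma> Z') (inv_into E \<sigma> Z) +
     bil Q Z Z' * bil \<omega> (\<sigma> Z') (inv_into E \<sigma> Z) = 0)"

text \<open>A meromorphic function on the irreducible projective variety C is a class, modulo
  equality on a nonempty Zariski open subset of C, of functions that are there a quotient of
  bihomogeneous polynomials of equal bidegree.  Values off that open subset (at the poles,
  for instance) are arbitrary.\<close>

definition generically ::
  "(('n::finite) proj \<times> 'n proj) set \<Rightarrow> ('n proj \<times> 'n proj \<Rightarrow> bool) \<Rightarrow> bool" where
  "generically C P \<longleftrightarrow> (\<exists>U. openin zariski2 U \<and> U \<inter> C \<noteq> {} \<and> (\<forall>x\<in>U \<inter> C. P x))"

definition mero_repr :: "(('n::finite) proj \<times> 'n proj) set \<Rightarrow> ('n proj \<times> 'n proj \<Rightarrow> complex) set" where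
  "mero_repr C = {f. \<exists>d e g h. bihomogeneous d e g \<and> bihomogeneous d e h \<and>
     (\<exists>x\<in>C. h (rep2 x) \<noteq> 0) \<and> generically C (\<lambda>x. f x = g (rep2 x) / h (rep2 x))}"

definition mero_repr_ring ::
  "(('n::finite) proj \<times> 'n proj) set \<Rightarrow> ('n proj \<times> 'n proj \<Rightarrow> complex) ring" where
  "mero_repr_ring C = \<lparr>carrier = mero_repr C, mult = (\<lambda>f g x. f x * g x), one = (\<lambda>_. 1),
     zero = (\<lambda>_. 0), add = (\<lambda>f g x. f x + g x)\<rparr>"

definition null_functions ::
  "(('n::finite) proj \<times> 'n proj) set \<Rightarrow> ('n proj \<times> 'n proj \<Rightarrow> complex) set" where
  "null_functions C = {f. generically C (\<lambda>x. f x = 0)}"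

definition mero_ring ::
  "(('n::finite) proj \<times> 'n proj) set \<Rightarrow> ('n proj \<times> 'n proj \<Rightarrow> complex) set ring" where
  "mero_ring C = mero_repr_ring C Quot null_functions C"

definition mero_class ::
  "(('n::finite) proj \<times> 'n proj) set \<Rightarrow> ('n proj \<times> 'n proj \<Rightarrow> complex) \<Rightarrow>
   ('n proj \<times> 'n proj \<Rightarrow> complex) set" where
  "mero_class C f = null_functions C +>\<^bsub>mero_repr_ring C\<^esub> f"

text \<open>\<open>free_algebra X\<close> is the free unital associative complex algebra on the set X: finitely
  supported functions on words, with concatenation product.\<close>

definition free_algebra :: "'x set \<Rightarrow> ('x list \<Rightarrow> complex) ring" where
  "free_algebra X =
     \<lparr>carrier = {p. finite {w. p w \<noteq> 0} \<and> (\<forall>w. p w \<noteq> 0 \<longrightarrow> set w \<subseteq> X)},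
      mult = (\<lambda>p q w. \<Sum>k\<le>length w. p (take k w) * q (drop k w)),
      one = (\<lambda>w. if w = [] then 1 else 0),
      zero = (\<lambda>_. 0),
      add = (\<lambda>p q w. p w + q w)\<rparr>"

definition scalar :: "complex \<Rightarrow> 'x list \<Rightarrow> complex" where
  "scalar c w = (if w = [] then c else 0)"

definition letter :: "'x \<Rightarrow> 'x list \<Rightarrow> complex" where
  "letter x w = (if w = [x] then 1 else 0)"

definition presented :: "'x set \<Rightarrow> ('x list \<Rightarrow> complex) set \<Rightarrow> ('x list \<Rightarrow> complex) set ring" where
  "presented X S = free_algebra X Quot genideal (free_algebra X) S"

definition pclass ::
  "'x set \<Rightarrow> ('x list \<Rightarrow> complex) set \<Rightarrow> ('x list \<Rightarrow> complex) \<Rightarrow> ('x list \<Rightarrow> complex) set" where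
  "pclass X S p = genideal (free_algebra X) S +>\<^bsub>free_algebra X\<^esub> p"

text \<open>\<open>extensional\<close> fixes the irrelevant values off the
  carrier, so that equality of homomorphisms is equality on the carrier.\<close>

definition algebra_homs ::
  "'x set \<Rightarrow> ('x list \<Rightarrow> complex) set \<Rightarrow> 'y set \<Rightarrow> ('y list \<Rightarrow> complex) set \<Rightarrow>
   (('x list \<Rightarrow> complex) set \<Rightarrow> ('y list \<Rightarrow> complex) set) set" where
  "algebra_homs X S Y T =
     {h \<in> ring_hom (presented X S) (presented Y T) \<inter> extensional (carrier (presented X S)).
        \<forall>c. h (pclass X S (scalar c)) = pclass Y T (scalar c)}"

text \<open>With \<open>V = complex^'n\<close>, the tensor algebra \<open>T(V)\<close> is \<open>free_algebra UNIV\<close> over the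
  index type: the restriction of an element to words of length k is a tensor in the
  k-th tensor power of V, in coordinates.\<close>

definition tensor1 :: "complex^'n \<Rightarrow> 'n list \<Rightarrow> complex" where
  "tensor1 Y w = (case w of [i] \<Rightarrow> Y $ i | _ \<Rightarrow> 0)"

definition tensor2 :: "complex^('n::finite \<times> 'n) \<Rightarrow> 'n list \<Rightarrow> complex" where
  "tensor2 B w = (case w of [i, j] \<Rightarrow> B $ (i, j) | _ \<Rightarrow> 0)"

abbreviation quadratic_algebra ::
  "(complex^('n::finite \<times> 'n)) set \<Rightarrow> ('n list \<Rightarrow> complex) set ring" where
  "quadratic_algebra R \<equiv> presented UNIV (tensor2 ` R)"

abbreviation quad_class ::
  "(complex^('n::finite \<times> 'n)) set \<Rightarrow> ('n list \<Rightarrow> complex) \<Rightarrow> ('n list \<Rightarrow> complex) set" where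
  "quad_class R \<equiv> pclass UNIV (tensor2 ` R)"

datatype 'm cross_gen = Mero 'm | Wgen | Wgen'

type_synonym 'n cross_letter = "('n proj \<times> 'n proj \<Rightarrow> complex) set cross_gen"

definition cross_gens :: "(('n::finite) proj \<times> 'n proj) set \<Rightarrow> 'n cross_letter set" where
  "cross_gens C = Mero ` carrier (mero_ring C) \<union> {Wgen, Wgen'}"

abbreviation mero_letter ::
  "(('n::finite) proj \<times> 'n proj) set \<Rightarrow> ('n proj \<times> 'n proj \<Rightarrow> complex) \<Rightarrow> 'n cross_letter list \<Rightarrow> complex" where
  "mero_letter C f \<equiv> letter (Mero (mero_class C f))"

definition cross_pi ::
  "complex^'n \<Rightarrow> complex^'n \<Rightarrow> complex^('n::finite \<times> 'n) \<Rightarrow> 'n proj \<times> 'n proj \<Rightarrow> complex" where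
  "cross_pi L L' Q = (\<lambda>(Z, Z'). lin L Z * lin L' Z' / bil Q Z Z')"

text \<open>The first three families of relations say that the meromorphic functions form a
  (unital) complex subalgebra.\<close>

definition cross_rels ::
  "'n proj set \<Rightarrow> ('n proj \<Rightarrow> 'n proj) \<Rightarrow> ('n proj \<times> 'n proj) set \<Rightarrow>
   complex^('n::finite \<times> 'n) \<Rightarrow> complex^'n \<Rightarrow> complex^'n \<Rightarrow> ('n cross_letter list \<Rightarrow> complex) set" where
  "cross_rels E \<sigma> C Q L L' = (let F = free_algebra (cross_gens C); M = mero_repr C in
     {mero_letter C (\<lambda>_. c) \<ominus>\<^bsub>F\<^esub> scalar c | c. True}
   \<union> {mero_letter C (\<lambda>x. f x + g x) \<ominus>\<^bsub>F\<^esub> (mero_letter C f \<oplus>\<^bsub>F\<^esub> mero_letter C g)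
        | f g. f \<in> M \<and> g \<in> M}
   \<union> {mero_letter C (\<lambda>x. f x * g x) \<ominus>\<^bsub>F\<^esub> (mero_letter C f \<otimes>\<^bsub>F\<^esub> mero_letter C g)
        | f g. f \<in> M \<and> g \<in> M}
   \<union> {letter Wgen \<otimes>\<^bsub>F\<^esub> mero_letter C f \<ominus>\<^bsub>F\<^esub> mero_letter C (f \<circ> sigma_tilde E \<sigma>) \<otimes>\<^bsub>F\<^esub> letter Wgen
        | f. f \<in> M}
   \<union> {letter Wgen' \<otimes>\<^bsub>F\<^esub> mero_letter C f \<ominus>\<^bsub>F\<^esub> mero_letter C (f \<circ> sigma_tilde_inv E \<sigma>) \<otimes>\<^bsub>F\<^esub> letter Wgen'
        | f. f \<in> M}
   \<union> {letter Wgen \<otimes>\<^bsub>F\<^esub> letter Wgen' \<ominus>\<^bsub>F\<^esub> mero_letter C (cross_pi L L' Q)}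
   \<union> {letter Wgen' \<otimes>\<^bsub>F\<^esub> letter Wgen \<ominus>\<^bsub>F\<^esub> mero_letter C (cross_pi L L' Q \<circ> sigma_tilde_inv E \<sigma>)})"

text \<open>The set of algebra homomorphisms from \<open>quadratic_algebra R\<close> to \<open>C\<^sub>Q\<close> satisfying
  \<open>\<surd>2 \<rho>(Y) = Y(Z)/L(Z) W\<^sub>L + W'\<^sub>L\<^sub>' Y(Z')/L'(Z')\<close>.\<close>

definition cross_homs ::
  "(complex^('n::finite \<times> 'n)) set \<Rightarrow> 'n proj set \<Rightarrow> ('n proj \<Rightarrow> 'n proj) \<Rightarrow> ('n proj \<times> 'n proj) set \<Rightarrow>
   complex^('n::finite \<times> 'n) \<Rightarrow> complex^'n \<Rightarrow> complex^'n \<Rightarrow>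
   (('n list \<Rightarrow> complex) set \<Rightarrow> ('n cross_letter list \<Rightarrow> complex) set) set" where
  "cross_homs R E \<sigma> C Q L L' =
     (let G = cross_gens C; S = cross_rels E \<sigma> C Q L L'; A = presented G S; q = pclass G S in
      {\<rho> \<in> algebra_homs UNIV (tensor2 ` R) G S. \<forall>Y.
         q (scalar (of_real (sqrt 2))) \<otimes>\<^bsub>A\<^esub> \<rho> (quad_class R (tensor1 Y)) =
         q (mero_letter C (\<lambda>(Z, Z'). lin Y Z / lin L Z)) \<otimes>\<^bsub>A\<^esub> q (letter Wgen)
         \<oplus>\<^bsub>A\<^esub> q (letter Wgen') \<otimes>\<^bsub>A\<^esub> q (mero_letter C (\<lambda>(Z, Z'). lin Y Z' / lin L' Z'))})"

end

theory Submission
  imports Defs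
begin

text \<open>
  Put \<open>\<tau> = (\<sigma>, \<sigma>\<^sup>-\<^sup>1)\<close>.  For \<open>B \<in> V \<otimes> V\<close>, moving all functions past \<open>W\<close> and \<open>W'\<close> turns the image of
  \<open>2 B\<close> into
  \<open>B(Z, \<sigma> Z) / (L(Z) L(\<sigma> Z)) W\<^sup>2 + B(Z, Z') / Q(Z, Z') + B(\<sigma> Z', \<sigma>\<^sup>-\<^sup>1 Z) / Q(\<sigma>\<^sup>-\<^sup>1 Z, \<sigma> Z')
  + W'\<^sup>2 B(\<sigma>\<^sup>-\<^sup>1 Z', Z') / (L'(\<sigma>\<^sup>-\<^sup>1 Z') L'(Z'))\<close>.
  For \<open>B \<in> R\<close> the outer terms vanish because \<open>\<Gamma>\<close> is the graph of \<open>\<sigma>\<close>, and the middle ones cancel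
  because \<open>Q\<close> is central and symmetric.  For \<open>B = Q\<close> the middle terms add up to 2.  Centrality at
  \<open>(Z, \<sigma> Z)\<close> reads \<open>Q(Z, \<sigma> Z) \<omega>(\<sigma>\<^sup>2 Z, \<sigma>\<^sup>-\<^sup>1 Z) = 0\<close> for all \<open>\<omega> \<in> R\<close>, so \<open>Q(Z, \<sigma> Z) \<noteq> 0\<close> puts
  \<open>(\<sigma>\<^sup>2 Z, \<sigma>\<^sup>-\<^sup>1 Z)\<close> on \<open>\<Gamma>\<close> and forces \<open>\<sigma>\<^sup>4 Z = Z\<close>; hence \<open>Q(Z, \<sigma> Z)\<close> vanishes generically.
\<close>

section \<open>Free and presented algebras\<close>

text \<open>\<open>C_Q\<close> is given by generators and relations, and no basis of it is needed:
  the identities below follow from the relations, so a coefficient has to be known only as a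
  meromorphic class, that is, on some nonempty open part of \<open>C\<close>. Irreducibility of
  \<open>C\<close> allows several such generic statements to be combined.

  Two obstacles shape the geometry. Points are evaluated at chosen representatives, so local
  formulas for regular maps hold up to nonzero scalars that must cancel; and \<sigma> is polynomial
  only locally, so composing a meromorphic function with \<tau> has to be justified in a chart.

  In the second assertion centrality is wanted on the graph of \<sigma> but given on
  \<open>C\<close>, which may be a product of two different sets and then need not contain the graph
  points in question. Moreover each outer term sees one factor of \<open>C\<close> only, and
  \<sigma>^4 may be trivial on one factor and not on the other. This is the origin of the premises
  there. One point moved by \<sigma>^4 in each factor suffices, because being moved is an open
  condition and \<open>C\<close> is irreducible.\<close>

lemma free_algebra_simps [simp]:
  "carrier (free_algebra X) = {p. finite {w. p w \<noteq> 0} \<and> (\<forall>w. p w \<noteq> 0 \<longrightarrow> set w \<subseteq> X)}"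
  "\<zero>\<^bsub>free_algebra X\<^esub> = (\<lambda>_. 0)"
  "p \<oplus>\<^bsub>free_algebra X\<^esub> q = (\<lambda>w. p w + q w)"
  by (simp_all add: free_algebra_def)

lemma free_algebra_one: "\<one>\<^bsub>free_algebra X\<^esub> = scalar 1"
  by (simp add: free_algebra_def scalar_def fun_eq_iff)

lemma free_algebra_mult_apply:
  "(p \<otimes>\<^bsub>free_algebra X\<^esub> q) w = (\<Sum>k\<le>length w. p (take k w) * q (drop k w))"
  by (simp add: free_algebra_def)

text \<open>Monomials with a coefficient. Scalars and letters are the cases of length 0 and 1, so
  one product formula serves both, and additive statements need checking on monomials only.\<close>

definition word_term :: "complex \<Rightarrow> 'x list \<Rightarrow> 'x list \<Rightarrow> complex" where
  "word_term c w = (\<lambda>v. if v = w then c else 0)"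

lemma scalar_eq_word_term: "scalar c = word_term c []"
  by (simp add: scalar_def word_term_def fun_eq_iff)

lemma letter_eq_word_term: "letter x = word_term 1 [x]"
  by (simp add: letter_def word_term_def fun_eq_iff)

lemma word_term_in_carrier [simp]: "set w \<subseteq> X \<Longrightarrow> word_term c w \<in> carrier (free_algebra X)"
  by (auto simp: word_term_def intro: finite_subset[of _ "{w}"])

lemma scalar_in_carrier [simp]: "scalar c \<in> carrier (free_algebra X)"
  unfolding scalar_eq_word_term by (rule word_term_in_carrier) simp

lemma letter_in_carrier [simp]: "x \<in> X \<Longrightarrow> letter x \<in> carrier (free_algebra X)"
  unfolding letter_eq_word_term by (rule word_term_in_carrier) simp

text \<open>Of all cuts of a word only the one at \<open>length u\<close> can leave \<open>u\<close>
  on the left, so at most one summand of the convolution survives.\<close>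

lemma word_term_mult:
  "word_term c u \<otimes>\<^bsub>free_algebra X\<^esub> word_term d v = word_term (c * d) (u @ v)"
proof (rule ext)
  fix w
  have "(word_term c u \<otimes>\<^bsub>free_algebra X\<^esub> word_term d v) w =
      (\<Sum>k\<le>length w. if k = length u \<and> w = u @ v then c * d else 0)"
    unfolding free_algebra_mult_apply
  proof (rule sum.cong)
    fix k assume k: "k \<in> {..length w}"
    have "take k w = u \<and> drop k w = v \<longleftrightarrow> k = length u \<and> w = u @ v"
      using k by (auto simp: append_eq_conv_conj)
    then show "word_term c u (take k w) * word_term d v (drop k w) =
        (if k = length u \<and> w = u @ v then c * d else 0)"
      by (auto simp: word_term_def)
  qed simp
  also have "\<dots> = word_term (c * d) (u @ v) w"
    by (cases "w = u @ v") (auto simp: word_term_def)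
  finally show "(word_term c u \<otimes>\<^bsub>free_algebra X\<^esub> word_term d v) w = word_term (c * d) (u @ v) w" .
qed

lemma word_term_Cons: "word_term c (x # w) = letter x \<otimes>\<^bsub>free_algebra X\<^esub> word_term c w"
  by (simp add: letter_eq_word_term word_term_mult)

text \<open>A nonzero value of the convolution at \<open>w\<close> needs a cut of \<open>w\<close>
  into two support words, so the support lies in the image of a finite product under
  concatenation.\<close>

lemma free_algebra_mult_closed:
  assumes "p \<in> carrier (free_algebra X)" "q \<in> carrier (free_algebra X)"
  shows "p \<otimes>\<^bsub>free_algebra X\<^esub> q \<in> carrier (free_algebra X)"
proof -
  let ?D = "(\<lambda>(u, v). u @ v) ` ({w. p w \<noteq> 0} \<times> {w. q w \<noteq> 0})"
  have D: "w \<in> ?D" if nz: "(p \<otimes>\<^bsub>free_algebra X\<^esub> q) w \<noteq> 0" for w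
  proof -
    obtain k where "p (take k w) * q (drop k w) \<noteq> 0"
      using sum.not_neutral_contains_not_neutral[OF nz[unfolded free_algebra_mult_apply]] by blast
    then have "(take k w, drop k w) \<in> {w. p w \<noteq> 0} \<times> {w. q w \<noteq> 0}" by simp
    then show ?thesis by (rule rev_image_eqI) simp
  qed
  have "finite ?D" using assms by auto
  moreover have sub: "{w. (p \<otimes>\<^bsub>free_algebra X\<^esub> q) w \<noteq> 0} \<subseteq> ?D"
    by (rule subsetI, rule D, erule CollectD)
  ultimately have "finite {w. (p \<otimes>\<^bsub>free_algebra X\<^esub> q) w \<noteq> 0}"
    by (rule finite_subset[rotated])
  moreover have "set w \<subseteq> X" if "w \<in> ?D" for w using that assms by fastforce
  ultimately show ?thesis using sub by (simp only: free_algebra_simps(1)) blast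
qed

text \<open>Both sides sum over two cut points of the same word: the left one fixes the outer cut
  \<open>k\<close> and then \<open>j \<le> k\<close>, the right one fixes \<open>j\<close> and then
  the distance \<open>i = k - j\<close>. Only the order of summation differs.\<close>

lemma free_algebra_mult_assoc:
  "(p \<otimes>\<^bsub>free_algebra X\<^esub> q) \<otimes>\<^bsub>free_algebra X\<^esub> r = p \<otimes>\<^bsub>free_algebra X\<^esub> (q \<otimes>\<^bsub>free_algebra X\<^esub> r)"
proof (rule ext)
  fix w :: "'a list"
  let ?n = "length w"
  define f where "f j k = p (take j w) * q (drop j (take k w)) * r (drop k w)" for j k
  have "((p \<otimes>\<^bsub>free_algebra X\<^esub> q) \<otimes>\<^bsub>free_algebra X\<^esub> r) w = (\<Sum>k\<le>?n. \<Sum>j\<le>k. f j k)"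
    unfolding free_algebra_mult_apply sum_distrib_right f_def
    by (intro sum.cong) (auto simp: min_def)
  also have "\<dots> = (\<Sum>k\<le>?n. \<Sum>j\<le>k. f j (j + (k - j)))"
    by (intro sum.cong) auto
  also have "\<dots> = (\<Sum>(j, i)\<in>{(j, i). j + i \<le> ?n}. f j (j + i))"
    by (rule sum.triangle_reindex_eq[symmetric])
  also have "{(j, i). j + i \<le> ?n} = (SIGMA j:{..?n}. {..?n - j})"
    by auto
  also have "(\<Sum>(j, i)\<in>(SIGMA j:{..?n}. {..?n - j}). f j (j + i)) = (\<Sum>j\<le>?n. \<Sum>i\<le>?n - j. f j (j + i))"
    by (rule sum.Sigma[symmetric]) auto
  also have "\<dots> = (p \<otimes>\<^bsub>free_algebra X\<^esub> (q \<otimes>\<^bsub>free_algebra X\<^esub> r)) w"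
    unfolding free_algebra_mult_apply sum_distrib_left f_def
    by (intro sum.cong) (simp_all add: take_drop add.commute mult.assoc)
  finally show "((p \<otimes>\<^bsub>free_algebra X\<^esub> q) \<otimes>\<^bsub>free_algebra X\<^esub> r) w =
    (p \<otimes>\<^bsub>free_algebra X\<^esub> (q \<otimes>\<^bsub>free_algebra X\<^esub> r)) w" .
qed

lemma scalar_mult_apply: "(scalar c \<otimes>\<^bsub>free_algebra X\<^esub> p) w = c * p w"
proof -
  have "(scalar c \<otimes>\<^bsub>free_algebra X\<^esub> p) w = (\<Sum>k\<le>length w. if k = 0 then c * p w else 0)"
    unfolding free_algebra_mult_apply by (intro sum.cong) (auto simp: scalar_def)
  then show ?thesis by simp
qed

lemma mult_scalar_apply: "(p \<otimes>\<^bsub>free_algebra X\<^esub> scalar c) w = c * p w"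
proof -
  have "(p \<otimes>\<^bsub>free_algebra X\<^esub> scalar c) w = (\<Sum>k\<le>length w. if k = length w then c * p w else 0)"
    unfolding free_algebra_mult_apply by (intro sum.cong) (auto simp: scalar_def)
  then show ?thesis by simp
qed

lemma scalar_central: "scalar c \<otimes>\<^bsub>free_algebra X\<^esub> p = p \<otimes>\<^bsub>free_algebra X\<^esub> scalar c"
  by (simp add: fun_eq_iff scalar_mult_apply mult_scalar_apply)

lemma free_algebra_ring: "ring (free_algebra X)"
proof (rule ringI)
  show "abelian_group (free_algebra X)"
  proof (rule abelian_groupI)
    fix p q assume "p \<in> carrier (free_algebra X)" "q \<in> carrier (free_algebra X)"
    then have "finite ({w. p w \<noteq> 0} \<union> {w. q w \<noteq> 0})"
      "\<And>w. w \<in> {w. p w \<noteq> 0} \<union> {w. q w \<noteq> 0} \<Longrightarrow> set w \<subseteq> X" by auto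
    moreover have "{w. p w + q w \<noteq> 0} \<subseteq> {w. p w \<noteq> 0} \<union> {w. q w \<noteq> 0}" by auto
    ultimately show "p \<oplus>\<^bsub>free_algebra X\<^esub> q \<in> carrier (free_algebra X)"
      by (auto intro: finite_subset)
  next
    fix p assume "p \<in> carrier (free_algebra X)"
    then show "\<exists>q\<in>carrier (free_algebra X). q \<oplus>\<^bsub>free_algebra X\<^esub> p = \<zero>\<^bsub>free_algebra X\<^esub>"
      by (intro bexI[of _ "\<lambda>w. - p w"]) auto
  qed (auto simp: algebra_simps)
  show "Group.monoid (free_algebra X)"
  proof (rule monoidI)
    fix p assume "p \<in> carrier (free_algebra X)"
    show "\<one>\<^bsub>free_algebra X\<^esub> \<otimes>\<^bsub>free_algebra X\<^esub> p = p"
      unfolding free_algebra_one by (simp add: fun_eq_iff scalar_mult_apply)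
    show "p \<otimes>\<^bsub>free_algebra X\<^esub> \<one>\<^bsub>free_algebra X\<^esub> = p"
      unfolding free_algebra_one by (simp add: fun_eq_iff mult_scalar_apply)
  qed (simp_all only: free_algebra_one scalar_in_carrier free_algebra_mult_closed free_algebra_mult_assoc)
qed (auto simp: free_algebra_mult_apply algebra_simps sum.distrib fun_eq_iff)

lemma free_algebra_induct [consumes 1, case_names zero word_term add]:
  assumes "p \<in> carrier (free_algebra X)"
    and zero: "P (\<lambda>_. 0)"
    and word_term: "\<And>c w. set w \<subseteq> X \<Longrightarrow> P (word_term c w)"
    and add: "\<And>p q. \<lbrakk>p \<in> carrier (free_algebra X); q \<in> carrier (free_algebra X); P p; P q\<rbrakk>
      \<Longrightarrow> P (p \<oplus>\<^bsub>free_algebra X\<^esub> q)"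
  shows "P p"
proof -
  \<comment> \<open>The induction runs over a finite set \<open>B\<close> containing the support
    rather than over the support itself, so that deleting a word from \<open>B\<close> is always
    matched by setting one coefficient of \<open>p\<close> to 0.\<close>
  have "\<lbrakk>{w. p w \<noteq> 0} \<subseteq> B; \<forall>w\<in>B. set w \<subseteq> X\<rbrakk> \<Longrightarrow> P p" if "finite B" for B
    using that
  proof (induction B arbitrary: p)
    case empty
    then have "p = (\<lambda>_. 0)" by auto
    then show ?case using zero by simp
  next
    case (insert u B)
    let ?q = "p(u := 0)"
    have 1: "P ?q" using insert.prems by (intro insert.IH) auto
    have "finite {w. ?q w \<noteq> 0}"
      using insert.prems insert.hyps(1) by (auto intro: finite_subset[of _ B])
    then have 2: "?q \<in> carrier (free_algebra X)" using insert.prems by auto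
    have u: "set u \<subseteq> X" using insert.prems by auto
    have "p = word_term (p u) u \<oplus>\<^bsub>free_algebra X\<^esub> ?q"
      by (auto simp: word_term_def)
    then show ?case using add[OF word_term_in_carrier[OF u] 2 word_term[OF u] 1, of "p u"] by simp
  qed
  then show ?thesis using assms(1) by auto
qed

text \<open>A ring homomorphism need not be complex-linear, so agreement on scalars is demanded
  beside agreement on letters. Monomials are then settled by peeling off letters.\<close>

lemma free_algebra_hom_eqI:
  assumes f: "f \<in> ring_hom (free_algebra X) A" and g: "g \<in> ring_hom (free_algebra X) A"
    and A: "ring A"
    and scal: "\<And>c. f (scalar c) = g (scalar c)"
    and letters: "\<And>x. x \<in> X \<Longrightarrow> f (letter x) = g (letter x)"
    and p: "p \<in> carrier (free_algebra X)"
  shows "f p = g p"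
  using p
proof (induction rule: free_algebra_induct)
  case zero
  show ?case
    using ring_hom_zero[OF f free_algebra_ring A] ring_hom_zero[OF g free_algebra_ring A] by simp
next
  case (word_term c w)
  then show ?case
  proof (induction w)
    case Nil
    then show ?case using scal by (simp add: scalar_eq_word_term)
  next
    case (Cons x w)
    then have "letter x \<in> carrier (free_algebra X)" "word_term c w \<in> carrier (free_algebra X)"
      by (simp_all del: free_algebra_simps)
    then show ?case
      unfolding word_term_Cons[of _ _ _ X] using Cons letters
      by (simp add: ring_hom_mult[OF f] ring_hom_mult[OF g] del: free_algebra_simps)
  qed
next
  case (add p q)
  then show ?case by (simp add: ring_hom_add[OF f] ring_hom_add[OF g] del: free_algebra_simps)
qed

text \<open>The scalars of the target are given by \<open>s\<close>, since rings carry no module structure here.\<close>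

locale word_evaluation = ring A for A :: "('b, 'c) ring_scheme" (structure) +
  fixes X :: "'x set" and s :: "complex \<Rightarrow> 'b" and a :: "'x \<Rightarrow> 'b"
  assumes s_closed [simp]: "s c \<in> carrier A"
    and s_add: "s (c + d) = s c \<oplus> s d"
    and s_mult: "s (c * d) = s c \<otimes> s d"
    and s_one: "s 1 = \<one>"
    and s_central: "\<And>x. x \<in> carrier A \<Longrightarrow> s c \<otimes> x = x \<otimes> s c"
    and a_closed [simp]: "\<And>x. x \<in> X \<Longrightarrow> a x \<in> carrier A"
begin

definition eval_word :: "'x list \<Rightarrow> 'b" where
  "eval_word w = foldr (\<lambda>x y. a x \<otimes> y) w \<one>"

definition eval_free :: "('x list \<Rightarrow> complex) \<Rightarrow> 'b" where
  "eval_free p = (\<Oplus>w\<in>{w. p w \<noteq> 0}. s (p w) \<otimes> eval_word w)"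

lemma s_zero: "s 0 = \<zero>"
proof -
  have "s 0 \<oplus> s 0 = s 0" using s_add[of 0 0] by simp
  then show ?thesis using add.l_cancel_one s_closed by blast
qed

lemma eval_word_closed [simp]: "set w \<subseteq> X \<Longrightarrow> eval_word w \<in> carrier A"
  by (induction w) (auto simp: eval_word_def)

lemma eval_word_append:
  "\<lbrakk>set u \<subseteq> X; set v \<subseteq> X\<rbrakk> \<Longrightarrow> eval_word (u @ v) = eval_word u \<otimes> eval_word v"
proof (induction u)
  case Nil
  then show ?case by (simp add: eval_word_def[of "[]"])
next
  case (Cons x u)
  have C: "eval_word (x # w) = a x \<otimes> eval_word w" for w by (simp add: eval_word_def)
  show ?case using Cons by (simp add: C m_assoc)
qed

text \<open>Sums over different supports become comparable once they run over a common finite set;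
  the added words contribute \<open>s 0\<close>, which is zero.\<close>

lemma eval_free_superset:
  assumes "finite B" "{w. p w \<noteq> 0} \<subseteq> B" "\<forall>w\<in>B. set w \<subseteq> X"
  shows "eval_free p = (\<Oplus>w\<in>B. s (p w) \<otimes> eval_word w)"
  unfolding eval_free_def
  using assms by (intro add.finprod_mono_neutral_cong_left) (auto simp: s_zero)

lemma eval_word_term: "set w \<subseteq> X \<Longrightarrow> eval_free (word_term c w) = s c \<otimes> eval_word w"
  by (subst eval_free_superset[of "{w}"]) (auto simp: word_term_def)

lemma eval_free_closed: "p \<in> carrier (free_algebra X) \<Longrightarrow> eval_free p \<in> carrier A"
  unfolding eval_free_def by (intro finsum_closed) auto

lemma eval_free_add:
  assumes "p \<in> carrier (free_algebra X)" "q \<in> carrier (free_algebra X)"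
  shows "eval_free (p \<oplus>\<^bsub>free_algebra X\<^esub> q) = eval_free p \<oplus> eval_free q"
proof -
  let ?B = "{w. p w \<noteq> 0} \<union> {w. q w \<noteq> 0}"
  have B: "finite ?B" "\<forall>w\<in>?B. set w \<subseteq> X" using assms by auto
  have "eval_free (p \<oplus>\<^bsub>free_algebra X\<^esub> q) = (\<Oplus>w\<in>?B. s (p w + q w) \<otimes> eval_word w)"
    using B by (subst eval_free_superset[of ?B]) auto
  also have "\<dots> = (\<Oplus>w\<in>?B. s (p w) \<otimes> eval_word w \<oplus> s (q w) \<otimes> eval_word w)"
    using B by (intro add.finprod_cong') (auto simp: s_add l_distr)
  also have "\<dots> = (\<Oplus>w\<in>?B. s (p w) \<otimes> eval_word w) \<oplus> (\<Oplus>w\<in>?B. s (q w) \<otimes> eval_word w)"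
    using B by (intro finsum_addf) auto
  also have "\<dots> = eval_free p \<oplus> eval_free q"
    using B by (subst (1 2) eval_free_superset[of ?B]) auto
  finally show ?thesis .
qed

text \<open>The multiplication law is additive in each factor, so two nested inductions reduce it to
  a pair of monomials.\<close>

lemma eval_free_hom: "eval_free \<in> ring_hom (free_algebra X) A"
proof (rule ring_hom_memI)
  fix p q assume p: "p \<in> carrier (free_algebra X)" and q: "q \<in> carrier (free_algebra X)"
  show "eval_free p \<in> carrier A" using p by (rule eval_free_closed)
  show "eval_free (p \<oplus>\<^bsub>free_algebra X\<^esub> q) = eval_free p \<oplus> eval_free q"
    using p q by (rule eval_free_add)
  interpret F: ring "free_algebra X" by (rule free_algebra_ring)
  have z: "eval_free (\<lambda>_. 0) = \<zero>" by (simp add: eval_free_def)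
  have zl: "(\<lambda>_. 0) \<otimes>\<^bsub>free_algebra X\<^esub> q = (\<lambda>_. 0)" and zr: "q \<otimes>\<^bsub>free_algebra X\<^esub> (\<lambda>_. 0) = (\<lambda>_. 0)"
    for q :: "'x list \<Rightarrow> complex" by (simp_all add: fun_eq_iff free_algebra_mult_apply)
  show "eval_free (p \<otimes>\<^bsub>free_algebra X\<^esub> q) = eval_free p \<otimes> eval_free q"
    using p
  proof (induction rule: free_algebra_induct)
    case zero
    show ?case unfolding zl z using eval_free_closed[OF q] by simp
  next
    case (word_term c u)
    note u = this
    show ?case using q
    proof (induction rule: free_algebra_induct)
      case zero
      show ?case unfolding zr z using u by (simp add: eval_word_term)
    next
      case (word_term d v)
      have "(s c \<otimes> s d) \<otimes> (eval_word u \<otimes> eval_word v) = s c \<otimes> (s d \<otimes> eval_word u) \<otimes> eval_word v"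
        using u word_term by (simp add: m_assoc)
      \<comment> \<open>The coefficient of the right monomial has to cross the word of the left one;
        this is where centrality of the scalars enters.\<close>
      also have "s d \<otimes> eval_word u = eval_word u \<otimes> s d" using u by (simp add: s_central)
      finally show ?case
        using u word_term
        by (simp add: word_term_mult eval_word_term eval_word_append s_mult m_assoc)
    next
      case (add q r)
      then show ?case
        using word_term_in_carrier[OF u, of c]
        by (simp add: F.r_distr eval_free_add eval_free_closed free_algebra_mult_closed r_distr
            del: free_algebra_simps)
    qed
  next
    case (add p r)
    then show ?case
      using q by (simp add: F.l_distr eval_free_add eval_free_closed free_algebra_mult_closed l_distr
            del: free_algebra_simps)
  qed
next
  show "eval_free \<one>\<^bsub>free_algebra X\<^esub> = \<one>"
    unfolding free_algebra_one scalar_eq_word_term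
    by (simp add: eval_word_term s_one eval_word_def)
qed

lemma eval_scalar [simp]: "eval_free (scalar c) = s c"
  by (simp add: scalar_eq_word_term eval_word_term eval_word_def)

end

declare free_algebra_simps [simp del]

section \<open>Quotients by relations and their universal property\<close>

lemma genideal_free_algebra:
  assumes "S \<subseteq> carrier (free_algebra X)"
  shows "ideal (genideal (free_algebra X) S) (free_algebra X)"
  using ring.genideal_ideal[OF free_algebra_ring assms] .

lemma presented_ring: "S \<subseteq> carrier (free_algebra X) \<Longrightarrow> ring (presented X S)"
  unfolding presented_def by (intro ideal.quotient_is_ring genideal_free_algebra)

lemma pclass_hom: "S \<subseteq> carrier (free_algebra X) \<Longrightarrow> pclass X S \<in> ring_hom (free_algebra X) (presented X S)"
  unfolding presented_def pclass_def[abs_def]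
  by (intro ideal.rcos_ring_hom genideal_free_algebra)

lemma carrier_presented: "carrier (presented X S) = pclass X S ` carrier (free_algebra X)"
  unfolding presented_def pclass_def FactRing_def A_RCOSETS_def' by auto

lemma pclass_relation:
  assumes S: "S \<subseteq> carrier (free_algebra X)" and "r \<in> S"
  shows "pclass X S r = \<zero>\<^bsub>presented X S\<^esub>"
proof -
  interpret ideal "genideal (free_algebra X) S" "free_algebra X" by (rule genideal_free_algebra[OF S])
  have "r \<in> genideal (free_algebra X) S" using ring.genideal_self[OF free_algebra_ring S] assms(2) by blast
  then have "genideal (free_algebra X) S +>\<^bsub>free_algebra X\<^esub> r = genideal (free_algebra X) S"
    by (rule a_rcos_const)
  then show ?thesis by (simp only: presented_def pclass_def FactRing_def ring.simps)
qed

text \<open>The relations of \<open>C_Q\<close> are listed as differences; this turns each of them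
  into an equation between classes.\<close>

lemma pclass_diff_relation:
  assumes S: "S \<subseteq> carrier (free_algebra X)"
    and p: "p \<in> carrier (free_algebra X)" and q: "q \<in> carrier (free_algebra X)"
    and r: "p \<ominus>\<^bsub>free_algebra X\<^esub> q \<in> S"
  shows "pclass X S p = pclass X S q"
proof -
  interpret F: ring "free_algebra X" by (rule free_algebra_ring)
  interpret A: ring "presented X S" by (rule presented_ring[OF S])
  have "p = (p \<ominus>\<^bsub>free_algebra X\<^esub> q) \<oplus>\<^bsub>free_algebra X\<^esub> q"
    unfolding F.minus_eq F.add.m_assoc[OF p F.a_inv_closed[OF q] q] F.l_neg[OF q] F.r_zero[OF p] ..
  then have "pclass X S p = pclass X S (p \<ominus>\<^bsub>free_algebra X\<^esub> q) \<oplus>\<^bsub>presented X S\<^esub> pclass X S q"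
    using ring_hom_add[OF pclass_hom[OF S] F.minus_closed[OF p q] q] by simp
  also have "\<dots> = pclass X S q"
    unfolding pclass_relation[OF S r] using ring_hom_closed[OF pclass_hom[OF S] q] by simp
  finally show ?thesis .
qed

text \<open>The kernel of \<open>h\<close> is an ideal containing \<open>S\<close>, hence it
  contains the generated ideal. So \<open>h\<close> is constant on each coset, and its single value
  there defines \<open>k\<close>. The restriction to the carrier provides the extensionality that
  \<open>algebra_homs\<close> asks for.\<close>

lemma presented_lift:
  assumes S: "S \<subseteq> carrier (free_algebra X)" and A: "ring A"
    and h: "h \<in> ring_hom (free_algebra X) A" and rel: "\<And>r. r \<in> S \<Longrightarrow> h r = \<zero>\<^bsub>A\<^esub>"
  obtains k where "k \<in> ring_hom (presented X S) A" "k \<in> extensional (carrier (presented X S))"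
    "\<And>p. p \<in> carrier (free_algebra X) \<Longrightarrow> k (pclass X S p) = h p"
proof -
  let ?F = "free_algebra X" let ?I = "genideal (free_algebra X) S" let ?P = "presented X S"
  interpret F: ring ?F by (rule free_algebra_ring)
  interpret A: ring A by fact
  interpret I: ideal ?I ?F by (rule genideal_free_algebra[OF S])
  interpret H: ring_hom_ring ?F A h by (rule ring_hom_ringI2[OF F.ring_axioms A h])
  have ker: "?I \<subseteq> a_kernel ?F A h"
  proof (intro F.genideal_minimal H.kernel_is_ideal subsetI)
    fix r assume "r \<in> S"
    then show "r \<in> a_kernel ?F A h" using S rel unfolding a_kernel_def' by blast
  qed
  define k where "k = (\<lambda>K\<in>carrier ?P. the_elem (h ` K))"
  have k_eq: "k (pclass X S p) = h p" if p: "p \<in> carrier ?F" for p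
  proof -
    have "h y = h p" if "y \<in> ?I +>\<^bsub>?F\<^esub> p" for y
    proof -
      obtain i where i: "i \<in> ?I" "y = i \<oplus>\<^bsub>?F\<^esub> p"
        using \<open>y \<in> ?I +>\<^bsub>?F\<^esub> p\<close> by (auto simp only: a_r_coset_def')
      then have "i \<in> carrier ?F" "h i = \<zero>\<^bsub>A\<^esub>" using ker by (auto simp only: a_kernel_def')
      then show ?thesis using i p H.hom_closed by simp
    qed
    moreover have "p \<in> ?I +>\<^bsub>?F\<^esub> p" using p by (rule I.a_rcos_self)
    ultimately have "h ` (pclass X S p) = {h p}" unfolding pclass_def by blast
    then show ?thesis using p by (simp add: carrier_presented k_def)
  qed
  note pc = pclass_hom[OF S]
  have "k \<in> ring_hom ?P A"
  proof (rule ring_hom_memI)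
    fix x y assume "x \<in> carrier ?P" "y \<in> carrier ?P"
    then obtain p q where p: "p \<in> carrier ?F" "x = pclass X S p" and q: "q \<in> carrier ?F" "y = pclass X S q"
      unfolding carrier_presented by blast
    show "k x \<in> carrier A" unfolding p(2) k_eq[OF p(1)] using p(1) by (rule H.hom_closed)
    show "k (x \<otimes>\<^bsub>?P\<^esub> y) = k x \<otimes>\<^bsub>A\<^esub> k y"
      unfolding p(2) q(2) ring_hom_mult[OF pc p(1) q(1), symmetric] k_eq[OF F.m_closed[OF p(1) q(1)]]
        k_eq[OF p(1)] k_eq[OF q(1)] by (rule H.hom_mult[OF p(1) q(1)])
    show "k (x \<oplus>\<^bsub>?P\<^esub> y) = k x \<oplus>\<^bsub>A\<^esub> k y"
      unfolding p(2) q(2) ring_hom_add[OF pc p(1) q(1), symmetric] k_eq[OF F.a_closed[OF p(1) q(1)]]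
        k_eq[OF p(1)] k_eq[OF q(1)] by (rule H.hom_add[OF p(1) q(1)])
  next
    show "k \<one>\<^bsub>?P\<^esub> = \<one>\<^bsub>A\<^esub>"
      unfolding ring_hom_one[OF pc, symmetric] k_eq[OF F.one_closed] by (rule H.hom_one)
  qed
  moreover have "k \<in> extensional (carrier ?P)" unfolding k_def by simp
  ultimately show ?thesis using k_eq by (rule that)
qed

section \<open>Zariski topology and meromorphic functions\<close>

lemma function_algebra_comp:
  assumes "f \<in> function_algebra X" and "\<And>g. g \<in> X \<Longrightarrow> (\<lambda>x. g (\<phi> x)) \<in> function_algebra Y"
  shows "(\<lambda>x. f (\<phi> x)) \<in> function_algebra Y"
  using assms(1) by induction (auto intro: function_algebra.intros assms(2))

lemma function_algebra_bicomp:
  assumes "p \<in> function_algebra (range (\<lambda>i z. fst z $ i) \<union> range (\<lambda>i z. snd z $ i))"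
    and "\<And>i. (\<lambda>x. fst (\<phi> x) $ i) \<in> function_algebra Y" "\<And>i. (\<lambda>x. snd (\<phi> x) $ i) \<in> function_algebra Y"
  shows "(\<lambda>x. p (\<phi> x)) \<in> function_algebra Y"
  by (rule function_algebra_comp[OF assms(1)]) (use assms(2,3) in blast)

lemma function_algebra_sum:
  assumes "finite I" "\<And>i. i \<in> I \<Longrightarrow> f i \<in> function_algebra X"
  shows "(\<lambda>x. \<Sum>i\<in>I. f i x) \<in> function_algebra X"
  using assms by (induction I rule: finite_induct) (auto intro: function_algebra.intros)

lemma function_algebra_uminus:
  assumes "f \<in> function_algebra X"
  shows "(\<lambda>x. - f x) \<in> function_algebra X"
  using function_algebra.mult[OF function_algebra.const[of "-1"] assms] by simp

lemma bihomogeneousD: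
  "bihomogeneous d e p \<Longrightarrow>
    p \<in> function_algebra (range (\<lambda>i z. fst z $ i) \<union> range (\<lambda>i z. snd z $ i))"
  by (simp add: bihomogeneous_def)

lemma bihomogeneous_add:
  assumes "bihomogeneous d e p" "bihomogeneous d e q"
  shows "bihomogeneous d e (\<lambda>x. p x + q x)"
  using assms by (auto simp: bihomogeneous_def algebra_simps intro: function_algebra.add)

lemma bihomogeneous_uminus:
  assumes "bihomogeneous d e p"
  shows "bihomogeneous d e (\<lambda>x. - p x)"
  using assms by (auto simp: bihomogeneous_def intro: function_algebra_uminus)

lemma bihomogeneous_mult:
  assumes "bihomogeneous d e p" "bihomogeneous d' e' q"
  shows "bihomogeneous (d + d') (e + e') (\<lambda>x. p x * q x)"
  using assms by (auto simp: bihomogeneous_def power_add intro: function_algebra.mult)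

lemma bihomogeneous_sum:
  assumes "finite I" "\<And>i. i \<in> I \<Longrightarrow> bihomogeneous d e (p i)"
  shows "bihomogeneous d e (\<lambda>x. \<Sum>i\<in>I. p i x)"
  using assms by (auto simp: bihomogeneous_def sum_distrib_left intro!: function_algebra_sum)

lemma bihomogeneous_const: "bihomogeneous 0 0 (\<lambda>_. c)"
  by (auto simp: bihomogeneous_def intro: function_algebra.const)

lemma bihomogeneous_fst: "homogeneous d p \<Longrightarrow> bihomogeneous d 0 (\<lambda>x. p (fst x))"
proof -
  assume "homogeneous d p"
  then have p: "p \<in> function_algebra (range (\<lambda>i z. z $ i))" "\<forall>c z. p (c *s z) = c ^ d * p z"
    by (simp_all add: homogeneous_def)
  have "(\<lambda>x. p (fst x)) \<in> function_algebra (range (\<lambda>i z. fst z $ i) \<union> range (\<lambda>i z. snd z $ i))"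
    by (rule function_algebra_comp[OF p(1)]) (blast intro: function_algebra.gen)
  then show ?thesis using p(2) by (simp add: bihomogeneous_def)
qed

lemma bihomogeneous_snd: "homogeneous d p \<Longrightarrow> bihomogeneous 0 d (\<lambda>x. p (snd x))"
proof -
  assume "homogeneous d p"
  then have p: "p \<in> function_algebra (range (\<lambda>i z. z $ i))" "\<forall>c z. p (c *s z) = c ^ d * p z"
    by (simp_all add: homogeneous_def)
  have "(\<lambda>x. p (snd x)) \<in> function_algebra (range (\<lambda>i z. fst z $ i) \<union> range (\<lambda>i z. snd z $ i))"
    by (rule function_algebra_comp[OF p(1)]) (blast intro: function_algebra.gen)
  then show ?thesis using p(2) by (simp add: bihomogeneous_def)
qed

lemma homogeneous_component: "homogeneous 1 (\<lambda>z. z $ i)"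
  unfolding homogeneous_def by (auto intro: function_algebra.gen)

lemma homogeneous_const: "homogeneous 0 (\<lambda>_. c)"
  by (auto simp: homogeneous_def intro: function_algebra.const)

lemma homogeneous_sum:
  assumes "finite I" "\<And>i. i \<in> I \<Longrightarrow> homogeneous d (p i)"
  shows "homogeneous d (\<lambda>x. \<Sum>i\<in>I. p i x)"
  using assms by (auto simp: homogeneous_def sum_distrib_left intro!: function_algebra_sum)

lemma homogeneous_cmult: "homogeneous d p \<Longrightarrow> homogeneous d (\<lambda>x. c * p x)"
  by (auto simp: homogeneous_def intro!: function_algebra.mult function_algebra.const)

text \<open>Keeping the second variable fixed amounts to scaling it by 1, so its degree drops out.
  Slices are what irreducibility of products rests on.\<close>

lemma bihomogeneous_slice1:
  assumes "bihomogeneous d e p" shows "homogeneous d (\<lambda>z. p (z, z'))"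
  unfolding homogeneous_def
proof (intro conjI allI)
  show "(\<lambda>z. p (z, z')) \<in> function_algebra (range (\<lambda>i z. z $ i))"
    by (rule function_algebra_bicomp[OF bihomogeneousD[OF assms], where \<phi> = "\<lambda>z. (z, z')"])
      (auto intro: function_algebra.gen function_algebra.const)
  show "p (c *s z, z') = c ^ d * p (z, z')" for c z
    using assms unfolding bihomogeneous_def by (metis mult.right_neutral power_one scalar_mult_eq_scaleR vector_smult_lid)
qed

lemma bihomogeneous_slice2:
  assumes "bihomogeneous d e p" shows "homogeneous e (\<lambda>z'. p (z, z'))"
  unfolding homogeneous_def
proof (intro conjI allI)
  show "(\<lambda>z'. p (z, z')) \<in> function_algebra (range (\<lambda>i z. z $ i))"
    by (rule function_algebra_bicomp[OF bihomogeneousD[OF assms], where \<phi> = "\<lambda>z'. (z, z')"])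
      (auto intro: function_algebra.gen function_algebra.const)
  show "p (z, c *s z') = c ^ e * p (z, z')" for c z'
    using assms unfolding bihomogeneous_def by (metis mult.left_neutral power_one vector_smult_lid)
qed

lemma bihomogeneous_diag:
  assumes "bihomogeneous d e p" shows "homogeneous (d + e) (\<lambda>z. p (z, z))"
  unfolding homogeneous_def
proof (intro conjI allI)
  show "(\<lambda>z. p (z, z)) \<in> function_algebra (range (\<lambda>i z. z $ i))"
    by (rule function_algebra_bicomp[OF bihomogeneousD[OF assms], where \<phi> = "\<lambda>z. (z, z)"])
      (auto intro: function_algebra.gen function_algebra.const)
  show "p (c *s z, c *s z) = c ^ (d + e) * p (z, z)" for c z
    using assms unfolding bihomogeneous_def by (simp add: power_add)
qed

lemma bihomogeneous_comp:
  fixes F G :: "complex^'m \<Rightarrow> complex^'n"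
  assumes p: "bihomogeneous d e p"
    and F: "\<And>i. homogeneous a (\<lambda>z. F z $ i)" and G: "\<And>i. homogeneous b (\<lambda>z. G z $ i)"
  shows "bihomogeneous (a * d) (b * e) (\<lambda>x. p (F (fst x), G (snd x)))"
  unfolding bihomogeneous_def
proof (intro conjI allI)
  let ?Y = "range (\<lambda>i (z :: (complex^'m) \<times> (complex^'m)). fst z $ i) \<union> range (\<lambda>i z. snd z $ i)"
  have "(\<lambda>x. F (fst x) $ i) \<in> function_algebra ?Y" for i
    by (rule bihomogeneousD[OF bihomogeneous_fst[OF F]])
  moreover have "(\<lambda>x. G (snd x) $ i) \<in> function_algebra ?Y" for i
    by (rule bihomogeneousD[OF bihomogeneous_snd[OF G]])
  ultimately show "(\<lambda>x. p (F (fst x), G (snd x))) \<in> function_algebra ?Y"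
    by (intro function_algebra_bicomp[OF bihomogeneousD[OF p], where \<phi> = "\<lambda>x. (F (fst x), G (snd x))"]) auto
  fix c c' z z'
  have "F (c *s z) = c ^ a *s F z" "G (c' *s z') = c' ^ b *s G z'"
    using F G by (auto simp: homogeneous_def vec_eq_iff)
  then show "p (F (fst (c *s z, c' *s z')), G (snd (c *s z, c' *s z'))) =
      c ^ (a * d) * c' ^ (b * e) * p (F (fst (z, z')), G (snd (z, z')))"
    using p by (simp add: bihomogeneous_def power_mult)
qed

lemma homogeneous_lin: "homogeneous 1 (\<lambda>z. \<Sum>i\<in>UNIV. Y $ i * z $ i)"
  by (intro homogeneous_sum homogeneous_cmult homogeneous_component) auto

lemma bihomogeneous_bil:
  "bihomogeneous 1 1 (\<lambda>x. \<Sum>i\<in>UNIV. \<Sum>j\<in>UNIV. B $ (i, j) * fst x $ i * snd x $ j)"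
proof (intro bihomogeneous_sum)
  fix i j
  show "bihomogeneous 1 1 (\<lambda>x. B $ (i, j) * fst x $ i * snd x $ j)"
    using bihomogeneous_mult[OF bihomogeneous_fst[OF homogeneous_cmult[OF homogeneous_component]]
        bihomogeneous_snd[OF homogeneous_component], of "B $ (i, j)" i j]
    by simp
qed auto

section \<open>Zariski topologies and continuous maps\<close>

text \<open>The constant 1, of degree 0, puts the whole space among the generators. A generated
  topology lives on the union of its generators, so this settles \<open>topspace\<close>.\<close>

lemma UNIV_zariski_basic: "UNIV \<in> {{Z. p (rep_proj Z) \<noteq> 0} | p. \<exists>d. homogeneous d p}"
  by (rule CollectI, rule exI[of _ "\<lambda>_. 1"], intro conjI exI[of _ 0] homogeneous_const) simp

lemma UNIV_zariski2_basic: "UNIV \<in> {{x. p (rep2 x) \<noteq> 0} | p. \<exists>d e. bihomogeneous d e p}"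
  by (rule CollectI, rule exI[of _ "\<lambda>_. 1"], intro conjI exI[of _ 0] bihomogeneous_const) simp

lemma topspace_zariski [simp]: "topspace zariski = UNIV"
  unfolding zariski_def topology_generated_by_topspace
  using Union_upper[OF UNIV_zariski_basic] by (rule top.extremum_uniqueI)

lemma topspace_zariski2 [simp]: "topspace zariski2 = UNIV"
  unfolding zariski2_def topology_generated_by_topspace
  using Union_upper[OF UNIV_zariski2_basic] by (rule top.extremum_uniqueI)

lemma openin_zariski: "homogeneous d p \<Longrightarrow> openin zariski {Z. p (rep_proj Z) \<noteq> 0}"
  unfolding zariski_def by (rule topology_generated_by_Basis) blast

lemma openin_zariski2: "bihomogeneous d e p \<Longrightarrow> openin zariski2 {x. p (rep2 x) \<noteq> 0}"
  unfolding zariski2_def by (rule topology_generated_by_Basis) blast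

lemma continuous_map_zariskiI:
  fixes f :: "'a \<Rightarrow> 'n::finite proj"
  assumes "\<And>d p. homogeneous d p \<Longrightarrow> openin T {x \<in> topspace T. p (rep_proj (f x)) \<noteq> 0}"
  shows "continuous_map T zariski f"
  unfolding zariski_def
proof (rule continuous_on_generated_topo)
  fix U :: "'n proj set" assume "U \<in> {{Z. p (rep_proj Z) \<noteq> 0} |p. \<exists>d. homogeneous d p}"
  then obtain p d where "homogeneous d p" "U = {Z. p (rep_proj Z) \<noteq> 0}" by blast
  moreover from this have "f -` U \<inter> topspace T = {x \<in> topspace T. p (rep_proj (f x)) \<noteq> 0}" by auto
  ultimately show "openin T (f -` U \<inter> topspace T)" using assms by simp
next
  show "f ` topspace T \<subseteq> \<Union> {{Z. p (rep_proj Z) \<noteq> 0} |p. \<exists>d. homogeneous d p}"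
    by (rule subset_trans[OF subset_UNIV Union_upper[OF UNIV_zariski_basic]])
qed

lemma continuous_map_zariski2I:
  fixes f :: "'a \<Rightarrow> 'n::finite proj \<times> 'n proj"
  assumes "\<And>d e p. bihomogeneous d e p \<Longrightarrow> openin T {x \<in> topspace T. p (rep2 (f x)) \<noteq> 0}"
  shows "continuous_map T zariski2 f"
  unfolding zariski2_def
proof (rule continuous_on_generated_topo)
  fix U :: "('n proj \<times> 'n proj) set" assume "U \<in> {{x. p (rep2 x) \<noteq> 0} |p. \<exists>d e. bihomogeneous d e p}"
  then obtain p d e where "bihomogeneous d e p" "U = {x. p (rep2 x) \<noteq> 0}" by blast
  moreover from this have "f -` U \<inter> topspace T = {x \<in> topspace T. p (rep2 (f x)) \<noteq> 0}" by auto
  ultimately show "openin T (f -` U \<inter> topspace T)" using assms by simp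
next
  show "f ` topspace T \<subseteq> \<Union> {{x. p (rep2 x) \<noteq> 0} |p. \<exists>d e. bihomogeneous d e p}"
    by (rule subset_trans[OF subset_UNIV Union_upper[OF UNIV_zariski2_basic]])
qed

lemma continuous_map_zariski_fst: "continuous_map zariski2 zariski fst"
  by (rule continuous_map_zariskiI) (use openin_zariski2[OF bihomogeneous_fst] in simp)

lemma continuous_map_zariski_snd: "continuous_map zariski2 zariski snd"
  by (rule continuous_map_zariskiI) (use openin_zariski2[OF bihomogeneous_snd] in simp)

lemma continuous_map_zariski_diag: "continuous_map zariski zariski2 (\<lambda>Z. (Z, Z))"
  by (rule continuous_map_zariski2I) (use openin_zariski[OF bihomogeneous_diag] in simp)

lemma continuous_map_zariski_slice1: "continuous_map zariski zariski2 (\<lambda>Z. (Z, Z'))"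
  by (rule continuous_map_zariski2I) (use openin_zariski[OF bihomogeneous_slice1] in simp)

lemma continuous_map_zariski_slice2: "continuous_map zariski zariski2 (\<lambda>Z'. (Z, Z'))"
  by (rule continuous_map_zariski2I) (use openin_zariski[OF bihomogeneous_slice2] in simp)

section \<open>Irreducible sets and their products\<close>

lemma irreducible_inD:
  "\<lbrakk>irreducible_in T S; closedin T A; closedin T B; S \<subseteq> A \<union> B\<rbrakk> \<Longrightarrow> S \<subseteq> A \<or> S \<subseteq> B"
  by (simp add: irreducible_in_def)

lemma irreducible_in_image:
  assumes f: "continuous_map T T' f" and C: "irreducible_in T C"
  shows "irreducible_in T' (f ` C)"
  unfolding irreducible_in_def
proof (intro conjI allI impI)
  show "f ` C \<subseteq> topspace T'" "f ` C \<noteq> {}"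
    using f C by (auto simp: irreducible_in_def continuous_map_def)
  fix A B assume AB: "closedin T' A \<and> closedin T' B \<and> f ` C \<subseteq> A \<union> B"
  let ?v = "\<lambda>A. {x \<in> topspace T. f x \<in> A}"
  have "closedin T (?v A)" "closedin T (?v B)" "C \<subseteq> ?v A \<union> ?v B"
    using f C AB by (auto simp: irreducible_in_def intro: closedin_continuous_map_preimage)
  then have "C \<subseteq> ?v A \<or> C \<subseteq> ?v B" by (rule irreducible_inD[OF C])
  then show "f ` C \<subseteq> A \<or> f ` C \<subseteq> B" by blast
qed

text \<open>In general \<open>zariski2\<close> is finer than the product topology, so the argument
  rests on continuity of the slice maps instead of general facts on product spaces.\<close>

lemma irreducible_in_Times:
  assumes X: "irreducible_in zariski X" and Y: "irreducible_in zariski Y"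
  shows "irreducible_in zariski2 (X \<times> Y)"
  unfolding irreducible_in_def
proof (intro conjI allI impI)
  show "X \<times> Y \<subseteq> topspace zariski2" "X \<times> Y \<noteq> {}" using X Y by (auto simp: irreducible_in_def)
  fix A B assume AB: "closedin zariski2 A \<and> closedin zariski2 B \<and> X \<times> Y \<subseteq> A \<union> B"
  \<comment> \<open>\<open>v A\<close> collects the points whose whole slice over \<open>Y\<close>
    lies in \<open>A\<close>. It is closed as an intersection of closed slices, and irreducibility
    of \<open>Y\<close> puts every point of \<open>X\<close> into \<open>v A\<close> or
    \<open>v B\<close>.\<close>
  define v where "v A = {x. \<forall>y\<in>Y. (x, y) \<in> A}" for A :: "('a proj \<times> 'a proj) set"
  have slice: "closedin zariski {x. (x, y) \<in> A}" "closedin zariski {y. (x, y) \<in> A}"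
    if "closedin zariski2 A" for A x and y :: "'a proj"
    using closedin_continuous_map_preimage[OF continuous_map_zariski_slice1 that]
      closedin_continuous_map_preimage[OF continuous_map_zariski_slice2 that] by simp_all
  have Y0: "Y \<noteq> {}" using Y by (simp add: irreducible_in_def)
  have v: "closedin zariski (v A)" if "closedin zariski2 A" for A
  proof -
    have "v A = (\<Inter>y\<in>Y. {x. (x, y) \<in> A})" by (auto simp: v_def)
    then show ?thesis using slice(1)[OF that] Y0 by (auto intro!: closedin_Inter)
  qed
  have "X \<subseteq> v A \<union> v B"
  proof
    fix x assume "x \<in> X"
    then have "Y \<subseteq> {y. (x, y) \<in> A} \<union> {y. (x, y) \<in> B}" using AB by auto
    then have "Y \<subseteq> {y. (x, y) \<in> A} \<or> Y \<subseteq> {y. (x, y) \<in> B}"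
      using AB by (intro irreducible_inD[OF Y] slice(2)) auto
    then show "x \<in> v A \<union> v B" by (auto simp: v_def)
  qed
  then have "X \<subseteq> v A \<or> X \<subseteq> v B" using AB by (intro irreducible_inD[OF X] v) auto
  then show "X \<times> Y \<subseteq> A \<or> X \<times> Y \<subseteq> B" by (auto simp: v_def)
qed

text \<open>The component need not be a square \<open>E\<^sub>0 \<times> E\<^sub>0\<close>, only a product.\<close>

lemma irreducible_component_Times:
  assumes "irreducible_component zariski2 (E \<times> E) C"
  shows "C = fst ` C \<times> snd ` C"
proof -
  have irr: "irreducible_in zariski2 C" and sub: "C \<subseteq> E \<times> E"
    using assms by (auto simp: irreducible_component_def)
  have "irreducible_in zariski2 (fst ` C \<times> snd ` C)"
    by (intro irreducible_in_Times irreducible_in_image[OF _ irr]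
        continuous_map_zariski_fst continuous_map_zariski_snd)
  moreover have "C \<subseteq> fst ` C \<times> snd ` C" by force
  moreover have "fst ` C \<times> snd ` C \<subseteq> E \<times> E" using sub by auto
  ultimately show ?thesis using assms unfolding irreducible_component_def by blast
qed

section \<open>Generic properties\<close>

lemma generically_mono: "\<lbrakk>generically C P; \<And>x. x \<in> C \<Longrightarrow> P x \<Longrightarrow> P' x\<rbrakk> \<Longrightarrow> generically C P'"
  unfolding generically_def by blast

text \<open>Were the two open sets disjoint on \<open>C\<close>, their complements would be closed
  sets covering the irreducible \<open>C\<close>, and one of them would contain it.\<close>

lemma generically_conj:
  assumes C: "irreducible_in zariski2 C" and P: "generically C P" and P': "generically C P'"
  shows "generically C (\<lambda>x. P x \<and> P' x)"
proof -
  obtain U where U: "openin zariski2 U" "U \<inter> C \<noteq> {}" "\<forall>x\<in>U \<inter> C. P x"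
    using P unfolding generically_def by blast
  obtain V where V: "openin zariski2 V" "V \<inter> C \<noteq> {}" "\<forall>x\<in>V \<inter> C. P' x"
    using P' unfolding generically_def by blast
  have "closedin zariski2 (- U)" "closedin zariski2 (- V)"
    using U V closedin_diff[OF closedin_topspace, of zariski2] by (simp_all add: Compl_eq_Diff_UNIV)
  then have "U \<inter> V \<inter> C \<noteq> {}" using C U(2) V(2) unfolding irreducible_in_def by blast
  moreover have "openin zariski2 (U \<inter> V)" using U V by blast
  ultimately show ?thesis unfolding generically_def using U(3) V(3) by blast
qed

lemma generically_openin:
  assumes "openin (subtopology zariski2 C) W" "W \<noteq> {}"
  shows "generically C (\<lambda>x. x \<in> W)"
  using assms unfolding generically_def openin_subtopology by blast

lemma generically_nonzero:
  "\<lbrakk>bihomogeneous d e p; \<exists>x\<in>C. p (rep2 x) \<noteq> 0\<rbrakk> \<Longrightarrow> generically C (\<lambda>x. p (rep2 x) \<noteq> 0)"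
  unfolding generically_def by (intro exI[of _ "{x. p (rep2 x) \<noteq> 0}"]) (auto intro: openin_zariski2)

text \<open>Continuity makes the preimage open; it is nonempty because \<open>f\<close> maps
  \<open>C\<close> onto itself.\<close>

lemma generically_vimage:
  assumes f: "continuous_map (subtopology zariski2 C) zariski2 f" and C: "f ` C = C"
    and P: "generically C P"
  shows "generically C (\<lambda>x. P (f x))"
proof -
  obtain U where U: "openin zariski2 U" "U \<inter> C \<noteq> {}" "\<forall>x\<in>U \<inter> C. P x"
    using P unfolding generically_def by blast
  have "openin (subtopology zariski2 C) {x \<in> C. f x \<in> U}"
    using openin_continuous_map_preimage[OF f U(1)] by simp
  moreover obtain y where "y \<in> U" "y \<in> f ` C" using U(2) unfolding C by blast
  then have "{x \<in> C. f x \<in> U} \<noteq> {}" by blast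
  ultimately have "generically C (\<lambda>x. x \<in> {x \<in> C. f x \<in> U})" by (rule generically_openin)
  then show ?thesis by (rule generically_mono) (use U(3) C in blast)
qed

section \<open>Representatives of points, and the diagonal\<close>

lemma rep_proj_nonzero: "rep_proj Z \<noteq> 0"
  using Quotient3_rep_reflp[OF Quotient3_proj, of Z] by (simp add: proj_rel_def)

text \<open>The scalar \<open>c\<close> is the price of evaluating at a chosen representative; it
  reappears in every local formula for a regular map.\<close>

lemma rep_abs_proj:
  assumes "x \<noteq> 0" obtains c where "c \<noteq> 0" "rep_proj (abs_proj x) = c *s x"
proof -
  have "proj_rel x x" using assms by (auto simp: proj_rel_def intro: exI[of _ 1])
  then have "proj_rel x (rep_proj (abs_proj x))"
    using Quotient3_proj by (metis rep_abs_rsp)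
  then show ?thesis using that by (auto simp: proj_rel_def)
qed

lemma proj_eqI:
  assumes "rep_proj Z' = c *s rep_proj Z" shows "Z' = Z"
proof -
  have "c \<noteq> 0" using assms rep_proj_nonzero[of Z'] by auto
  then have "proj_rel (rep_proj Z) (rep_proj Z')"
    using assms rep_proj_nonzero[of Z] by (auto simp: proj_rel_def)
  then show ?thesis using Quotient3_proj by (metis Quotient3_rel_rep)
qed

text \<open>Two nonzero vectors are proportional exactly when all their 2 by 2 minors
  vanish.\<close>

lemma proj_neq_iff:
  "Z \<noteq> Z' \<longleftrightarrow> (\<exists>i j. rep_proj Z $ i * rep_proj Z' $ j - rep_proj Z $ j * rep_proj Z' $ i \<noteq> 0)"
proof
  assume ne: "Z \<noteq> Z'"
  show "\<exists>i j. rep_proj Z $ i * rep_proj Z' $ j - rep_proj Z $ j * rep_proj Z' $ i \<noteq> 0"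
  proof (rule ccontr)
    assume *: "\<not> ?thesis"
    obtain i where i: "rep_proj Z $ i \<noteq> 0" using rep_proj_nonzero[of Z] by (auto simp: vec_eq_iff)
    have "rep_proj Z' $ j = (rep_proj Z' $ i / rep_proj Z $ i) * rep_proj Z $ j" for j
    proof -
      have "rep_proj Z $ i * rep_proj Z' $ j - rep_proj Z $ j * rep_proj Z' $ i = 0" using * by simp
      then show ?thesis using i by (simp add: field_simps)
    qed
    then have "rep_proj Z' = (rep_proj Z' $ i / rep_proj Z $ i) *s rep_proj Z"
      unfolding vec_eq_iff vector_smult_component by blast
    then have "Z' = Z" by (rule proj_eqI)
    then show False using ne by simp
  qed
qed (auto simp: mult.commute)

text \<open>At a point off the diagonal some minor is nonzero, and minors are bihomogeneous of
  bidegree (1, 1), so the point has a basic open neighbourhood off the diagonal.\<close>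

lemma openin_zariski2_neq: "openin zariski2 {x :: 'n::finite proj \<times> 'n proj. fst x \<noteq> snd x}"
proof -
  have b: "bihomogeneous 1 1 (\<lambda>x. fst x $ i * snd x $ j - fst x $ j * snd x $ i)" for i j :: 'n
    using bihomogeneous_add[OF
        bihomogeneous_mult[OF bihomogeneous_fst[OF homogeneous_component[of i]]
          bihomogeneous_snd[OF homogeneous_component[of j]]]
        bihomogeneous_uminus[OF bihomogeneous_mult[OF bihomogeneous_fst[OF homogeneous_component[of j]]
          bihomogeneous_snd[OF homogeneous_component[of i]]]]]
    by simp
  show ?thesis
  proof (subst openin_subopen, intro ballI)
    fix x :: "'n proj \<times> 'n proj" assume "x \<in> {x. fst x \<noteq> snd x}"
    then obtain i j
      where "rep_proj (fst x) $ i * rep_proj (snd x) $ j - rep_proj (fst x) $ j * rep_proj (snd x) $ i \<noteq> 0"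
      using proj_neq_iff[of "fst x" "snd x"] by auto
    then show "\<exists>T. openin zariski2 T \<and> x \<in> T \<and> T \<subseteq> {x. fst x \<noteq> snd x}"
      using proj_neq_iff[of "fst y" "snd y" for y]
      by (intro exI[of _ "{y. (\<lambda>x. fst x $ i * snd x $ j - fst x $ j * snd x $ i) (rep2 y) \<noteq> 0}"]
          conjI openin_zariski2[OF b[of i j]]) auto
  qed
qed

text \<open>Near a given point, a pair of regular maps pulls a bihomogeneous polynomial back to a
  bihomogeneous polynomial, up to nonvanishing scalars coming from the choice of representatives.\<close>

lemma regular_map_pullback:
  assumes s: "regular_map_on E s" and t: "regular_map_on E t" and x: "x \<in> E \<times> E"
  obtains U a F b G where "openin zariski2 U" "x \<in> U"
    "\<And>i. homogeneous a (\<lambda>z. F z $ i)" "\<And>i. homogeneous b (\<lambda>z. G z $ i)"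
    "\<And>y. y \<in> U \<inter> E \<times> E \<Longrightarrow> \<exists>c c'. c \<noteq> 0 \<and> c' \<noteq> 0 \<and> (\<forall>d e p. bihomogeneous d e p \<longrightarrow>
      p (rep2 (map_prod s t y)) = c ^ d * c' ^ e * p (F (fst (rep2 y)), G (snd (rep2 y))))"
proof -
  obtain U a F where U: "openin zariski U" "fst x \<in> U" "\<And>i. homogeneous a (\<lambda>z. F z $ i)"
    "\<And>X. X \<in> U \<inter> E \<Longrightarrow> F (rep_proj X) \<noteq> 0 \<and> s X = abs_proj (F (rep_proj X))"
    using s x unfolding regular_map_on_def by (metis mem_Times_iff)
  obtain V b G where V: "openin zariski V" "snd x \<in> V" "\<And>i. homogeneous b (\<lambda>z. G z $ i)"
    "\<And>X. X \<in> V \<inter> E \<Longrightarrow> G (rep_proj X) \<noteq> 0 \<and> t X = abs_proj (G (rep_proj X))"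
    using t x unfolding regular_map_on_def by (metis mem_Times_iff)
  have "openin zariski2 {y. fst y \<in> U}" "openin zariski2 {y. snd y \<in> V}"
    using openin_continuous_map_preimage[OF continuous_map_zariski_fst U(1)]
      openin_continuous_map_preimage[OF continuous_map_zariski_snd V(1)] by simp_all
  then have op: "openin zariski2 ({y. fst y \<in> U} \<inter> {y. snd y \<in> V})" by blast
  show ?thesis
  proof (rule that[OF op _ U(3) V(3)])
    show "x \<in> {y. fst y \<in> U} \<inter> {y. snd y \<in> V}" using U(2) V(2) by simp
    fix y assume y: "y \<in> {y. fst y \<in> U} \<inter> {y. snd y \<in> V} \<inter> E \<times> E"
    have F: "F (rep_proj (fst y)) \<noteq> 0" "s (fst y) = abs_proj (F (rep_proj (fst y)))"
      and G: "G (rep_proj (snd y)) \<noteq> 0" "t (snd y) = abs_proj (G (rep_proj (snd y)))"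
      using U(4)[of "fst y"] V(4)[of "snd y"] y by auto
    obtain c where c: "c \<noteq> 0" "rep_proj (s (fst y)) = c *s F (rep_proj (fst y))"
      unfolding F(2) by (rule rep_abs_proj[OF F(1)])
    obtain c' where c': "c' \<noteq> 0" "rep_proj (t (snd y)) = c' *s G (rep_proj (snd y))"
      unfolding G(2) by (rule rep_abs_proj[OF G(1)])
    show "\<exists>c c'. c \<noteq> 0 \<and> c' \<noteq> 0 \<and> (\<forall>d e p. bihomogeneous d e p \<longrightarrow>
        p (rep2 (map_prod s t y)) = c ^ d * c' ^ e * p (F (fst (rep2 y)), G (snd (rep2 y))))"
      using c c' by (intro exI[of _ c] exI[of _ c']) (auto simp: bihomogeneous_def)
  qed
qed

text \<open>The scalars in the local formula do not affect whether a polynomial vanishes, so near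
  each point the preimage of a basic open set is the nonvanishing locus of the pulled back
  polynomial. Any \<open>C\<close> inside \<open>E \<times> E\<close> is allowed, because
  \<open>E \<times> E\<close> itself is needed later as well.\<close>

lemma continuous_map_regular:
  fixes s t :: "'n::finite proj \<Rightarrow> 'n proj"
  assumes s: "regular_map_on E s" and t: "regular_map_on E t" and C: "C \<subseteq> E \<times> E"
  shows "continuous_map (subtopology zariski2 C) zariski2 (map_prod s t)"
proof (rule continuous_map_zariski2I)
  fix d e and p :: "(complex^'n) \<times> (complex^'n) \<Rightarrow> complex" assume p: "bihomogeneous d e p"
  let ?W = "{x \<in> topspace (subtopology zariski2 C). p (rep2 (map_prod s t x)) \<noteq> 0}"
  show "openin (subtopology zariski2 C) ?W"
  proof (subst openin_subopen, intro ballI)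
    fix x assume x: "x \<in> ?W"
    then have "x \<in> E \<times> E" using C by auto
    then obtain U a F b G where U: "openin zariski2 U" "x \<in> U"
      and F: "\<And>i. homogeneous a (\<lambda>z. F z $ i)" and G: "\<And>i. homogeneous b (\<lambda>z. G z $ i)"
      and UE: "\<And>y. y \<in> U \<inter> E \<times> E \<Longrightarrow> \<exists>c c'. c \<noteq> 0 \<and> c' \<noteq> 0 \<and> (\<forall>d e p. bihomogeneous d e p \<longrightarrow>
        p (rep2 (map_prod s t y)) = c ^ d * c' ^ e * p (F (fst (rep2 y)), G (snd (rep2 y))))"
      by (rule regular_map_pullback[OF s t]) (rule that)
    have eq: "p (rep2 (map_prod s t y)) \<noteq> 0 \<longleftrightarrow> p (F (fst (rep2 y)), G (snd (rep2 y))) \<noteq> 0"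
      if "y \<in> U \<inter> C" for y
    proof -
      have "y \<in> U \<inter> E \<times> E" using that C by auto
      then obtain c c' where "c \<noteq> 0" "c' \<noteq> 0" "p (rep2 (map_prod s t y)) =
          c ^ d * c' ^ e * p (F (fst (rep2 y)), G (snd (rep2 y)))"
        using UE p by blast
      then show ?thesis by simp
    qed
    let ?V = "U \<inter> {y. p (F (fst (rep2 y)), G (snd (rep2 y))) \<noteq> 0}"
    have "openin zariski2 ?V"
      using U(1) openin_zariski2[OF bihomogeneous_comp[OF p F G]] by (intro openin_Int) auto
    then have "openin (subtopology zariski2 C) (?V \<inter> C)" by (auto simp: openin_subtopology)
    moreover have "x \<in> ?V \<inter> C" using x U(2) eq[of x] by auto
    moreover have "?V \<inter> C \<subseteq> ?W" using eq by auto
    ultimately show "\<exists>V. openin (subtopology zariski2 C) V \<and> x \<in> V \<and> V \<subseteq> ?W" by blast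
  qed
qed

section \<open>Arithmetic of meromorphic functions\<close>

lemma mero_reprI:
  assumes "bihomogeneous d e g" "bihomogeneous d e h" "\<exists>x\<in>C. h (rep2 x) \<noteq> 0"
    "\<And>x. f x = g (rep2 x) / h (rep2 x)" and "C \<noteq> {}"
  shows "f \<in> mero_repr C"
proof -
  have "generically C (\<lambda>x. f x = g (rep2 x) / h (rep2 x))"
    unfolding generically_def using assms(3,4) by (intro exI[of _ UNIV]) (auto simp: openin_topspace[of zariski2, simplified])
  then show ?thesis unfolding mero_repr_def using assms by blast
qed

text \<open>The definition asks only for a denominator that is nonzero somewhere, while division by
  0 yields 0. Irreducibility combines its nonvanishing with the formula for \<open>f\<close> on one
  open set, as computing with fractions demands.\<close>

lemma mero_repr_obtain:
  assumes C: "irreducible_in zariski2 C" and f: "f \<in> mero_repr C"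
  obtains d e p q where "bihomogeneous d e p" "bihomogeneous d e q" "\<exists>x\<in>C. q (rep2 x) \<noteq> 0"
    "generically C (\<lambda>x. q (rep2 x) \<noteq> 0 \<and> f x = p (rep2 x) / q (rep2 x))"
proof -
  obtain d e p q where *: "bihomogeneous d e p" "bihomogeneous d e q" "\<exists>x\<in>C. q (rep2 x) \<noteq> 0"
    "generically C (\<lambda>x. f x = p (rep2 x) / q (rep2 x))"
    using f unfolding mero_repr_def by blast
  then show ?thesis using that generically_conj[OF C generically_nonzero *(4)] by blast
qed

lemma generically_ex: "generically C P \<Longrightarrow> \<exists>x\<in>C. P x"
  unfolding generically_def by blast

lemma mero_repr_add:
  assumes C: "irreducible_in zariski2 C" and f: "f \<in> mero_repr C" and g: "g \<in> mero_repr C"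
  shows "(\<lambda>x. f x + g x) \<in> mero_repr C"
proof -
  obtain d e p q where f': "bihomogeneous d e p" "bihomogeneous d e q"
    "generically C (\<lambda>x. q (rep2 x) \<noteq> 0 \<and> f x = p (rep2 x) / q (rep2 x))"
    by (rule mero_repr_obtain[OF C f])
  obtain d' e' p' q' where g': "bihomogeneous d' e' p'" "bihomogeneous d' e' q'"
    "generically C (\<lambda>x. q' (rep2 x) \<noteq> 0 \<and> g x = p' (rep2 x) / q' (rep2 x))"
    by (rule mero_repr_obtain[OF C g])
  note gen = generically_conj[OF C f'(3) g'(3)]
  let ?n = "\<lambda>x. p x * q' x + q x * p' x" and ?m = "\<lambda>x. q x * q' x"
  have "bihomogeneous (d + d') (e + e') ?n" "bihomogeneous (d + d') (e + e') ?m"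
    using f' g' by (auto intro: bihomogeneous_add bihomogeneous_mult)
  moreover have "\<exists>x\<in>C. ?m (rep2 x) \<noteq> 0" using generically_ex[OF gen] by auto
  moreover have "generically C (\<lambda>x. f x + g x = ?n (rep2 x) / ?m (rep2 x))"
    by (rule generically_mono[OF gen]) (auto simp: field_simps)
  ultimately show ?thesis unfolding mero_repr_def by blast
qed

lemma mero_repr_mult:
  assumes C: "irreducible_in zariski2 C" and f: "f \<in> mero_repr C" and g: "g \<in> mero_repr C"
  shows "(\<lambda>x. f x * g x) \<in> mero_repr C"
proof -
  obtain d e p q where f': "bihomogeneous d e p" "bihomogeneous d e q"
    "generically C (\<lambda>x. q (rep2 x) \<noteq> 0 \<and> f x = p (rep2 x) / q (rep2 x))"
    by (rule mero_repr_obtain[OF C f])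
  obtain d' e' p' q' where g': "bihomogeneous d' e' p'" "bihomogeneous d' e' q'"
    "generically C (\<lambda>x. q' (rep2 x) \<noteq> 0 \<and> g x = p' (rep2 x) / q' (rep2 x))"
    by (rule mero_repr_obtain[OF C g])
  note gen = generically_conj[OF C f'(3) g'(3)]
  let ?n = "\<lambda>x. p x * p' x" and ?m = "\<lambda>x. q x * q' x"
  have "bihomogeneous (d + d') (e + e') ?n" "bihomogeneous (d + d') (e + e') ?m"
    using f' g' by (auto intro: bihomogeneous_mult)
  moreover have "\<exists>x\<in>C. ?m (rep2 x) \<noteq> 0" using generically_ex[OF gen] by auto
  moreover have "generically C (\<lambda>x. f x * g x = ?n (rep2 x) / ?m (rep2 x))"
    by (rule generically_mono[OF gen]) auto
  ultimately show ?thesis unfolding mero_repr_def by blast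
qed

lemma mero_repr_const: "C \<noteq> {} \<Longrightarrow> (\<lambda>_. c) \<in> mero_repr C"
  by (rule mero_reprI[OF bihomogeneous_const[of c] bihomogeneous_const[of 1]]) auto

lemma mero_repr_sum:
  assumes "irreducible_in zariski2 C" "finite I" "\<And>i. i \<in> I \<Longrightarrow> f i \<in> mero_repr C"
  shows "(\<lambda>x. \<Sum>i\<in>I. f i x) \<in> mero_repr C"
  using assms(2,3)
proof (induction I rule: finite_induct)
  case empty
  then show ?case using mero_repr_const[of C 0] assms(1) unfolding irreducible_in_def by simp
qed (auto intro!: mero_repr_add assms(1))

text \<open>A regular map is polynomial only locally, but one chart is enough: nonempty open subsets
  of the irreducible \<open>C\<close> meet each other, so the fraction found near a single point
  represents the composite generically.\<close>

lemma mero_repr_comp_regular: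
  assumes C: "irreducible_in zariski2 C" "C \<subseteq> E \<times> E"
    and s: "regular_map_on E s" and t: "regular_map_on E t" and CC: "map_prod s t ` C = C"
    and f: "f \<in> mero_repr C"
  shows "f \<circ> map_prod s t \<in> mero_repr C"
proof -
  let ?T = "map_prod s t"
  obtain d e p q where f': "bihomogeneous d e p" "bihomogeneous d e q"
    "generically C (\<lambda>x. q (rep2 x) \<noteq> 0 \<and> f x = p (rep2 x) / q (rep2 x))"
    by (rule mero_repr_obtain[OF C(1) f])
  note gen = generically_vimage[OF continuous_map_regular[OF s t C(2)] CC f'(3)]
  obtain x where x: "x \<in> C" using C by (auto simp: irreducible_in_def)
  then have "x \<in> E \<times> E" using C by auto
  then obtain U a F b G where U: "openin zariski2 U" "x \<in> U"
    and F: "\<And>i. homogeneous a (\<lambda>z. F z $ i)" and G: "\<And>i. homogeneous b (\<lambda>z. G z $ i)"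
    and UE: "\<And>y. y \<in> U \<inter> E \<times> E \<Longrightarrow> \<exists>c c'. c \<noteq> 0 \<and> c' \<noteq> 0 \<and> (\<forall>d e p. bihomogeneous d e p \<longrightarrow>
      p (rep2 (?T y)) = c ^ d * c' ^ e * p (F (fst (rep2 y)), G (snd (rep2 y))))"
    by (rule regular_map_pullback[OF s t]) (rule that)
  have "generically C (\<lambda>x. x \<in> U)" unfolding generically_def using U x by blast
  note gen' = generically_conj[OF C(1) gen this]
  let ?n = "\<lambda>x. p (F (fst x), G (snd x))" and ?m = "\<lambda>x. q (F (fst x), G (snd x))"
  have key: "?m (rep2 y) \<noteq> 0 \<and> (f \<circ> ?T) y = ?n (rep2 y) / ?m (rep2 y)"
    if "y \<in> C" "(q (rep2 (?T y)) \<noteq> 0 \<and> f (?T y) = p (rep2 (?T y)) / q (rep2 (?T y))) \<and> y \<in> U" for y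
  proof -
    have "y \<in> U \<inter> E \<times> E" using that C by auto
    from UE[OF this] obtain c c' where c: "c \<noteq> 0" "c' \<noteq> 0"
      and *: "\<And>d e p. bihomogeneous d e p \<Longrightarrow> p (rep2 (?T y)) = c ^ d * c' ^ e * p (F (fst (rep2 y)), G (snd (rep2 y)))"
      by blast
    \<comment> \<open>The scalars \<open>c\<close> and \<open>c'\<close> do not depend on the
      polynomial, and numerator and denominator have the same bidegree, so the scalars cancel in the
      fraction.\<close>
    show ?thesis using that(2) c unfolding *[OF f'(1)] *[OF f'(2)] comp_def by simp
  qed
  have "bihomogeneous (a * d) (b * e) ?n" "bihomogeneous (a * d) (b * e) ?m"
    using bihomogeneous_comp f'(1,2) F G by blast+
  moreover have "\<exists>x\<in>C. ?m (rep2 x) \<noteq> 0" using generically_ex[OF gen'] key by blast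
  moreover have "generically C (\<lambda>x. (f \<circ> ?T) x = ?n (rep2 x) / ?m (rep2 x))"
    by (rule generically_mono[OF gen']) (use key in blast)
  ultimately show ?thesis unfolding mero_repr_def by blast
qed

text \<open>If \<open>k\<close> is \<open>f\<close> plus a generically zero function, then
  \<open>k - g\<close> is generically zero too, so \<open>k\<close> lies in the class of
  \<open>g\<close>; the situation is symmetric.\<close>

lemma mero_class_cong:
  assumes C: "irreducible_in zariski2 C" and fg: "generically C (\<lambda>x. f x = g x)"
  shows "mero_class C f = mero_class C g"
proof -
  have *: "mero_class C f \<subseteq> mero_class C g" if fg: "generically C (\<lambda>x. f x = g x)" for f g
  proof
    fix k assume "k \<in> mero_class C f"
    then obtain h where h: "generically C (\<lambda>x. h x = 0)" "k = (\<lambda>x. h x + f x)"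
      by (auto simp: mero_class_def a_r_coset_def' mero_repr_ring_def null_functions_def)
    have "generically C (\<lambda>x. k x - g x = 0)"
      by (rule generically_mono[OF generically_conj[OF C h(1) fg]]) (simp add: h(2))
    then show "k \<in> mero_class C g"
      by (auto simp: mero_class_def a_r_coset_def' mero_repr_ring_def null_functions_def
          intro!: exI[of _ "\<lambda>x. k x - g x"])
  qed
  have "generically C (\<lambda>x. g x = f x)" by (rule generically_mono[OF fg]) simp
  then show ?thesis using *[OF fg] * by blast
qed

lemma mero_class_in_carrier: "f \<in> mero_repr C \<Longrightarrow> mero_class C f \<in> carrier (mero_ring C)"
  by (auto simp: mero_class_def mero_ring_def FactRing_def A_RCOSETS_def' mero_repr_ring_def)

section \<open>The homomorphism into the cross-product algebra\<close>

text \<open>Functions are collected to the left of \<open>W \<otimes> W\<close> and to the right of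
  \<open>W' \<otimes> W'\<close>, as in the formula for \<rho>. In the product of \<open>W'\<close>
  and \<open>W\<close> they stand between the generators and are moved out to the left as one factor
  \<open>k'\<close>.\<close>

lemma (in ring) cross_product_expand:
  assumes c: "m1 \<in> carrier R" "m2 \<in> carrier R" "m2' \<in> carrier R" "n1 \<in> carrier R" "n1' \<in> carrier R"
      "n2 \<in> carrier R" "k' \<in> carrier R" "W \<in> carrier R" "W' \<in> carrier R"
    and W: "W \<otimes> m2 = m2' \<otimes> W" and n: "n1 \<otimes> W' = W' \<otimes> n1'" and k: "W' \<otimes> (n1 \<otimes> m2) = k' \<otimes> W'"
  shows "(m1 \<otimes> W \<oplus> W' \<otimes> n1) \<otimes> (m2 \<otimes> W \<oplus> W' \<otimes> n2) =
    m1 \<otimes> m2' \<otimes> (W \<otimes> W) \<oplus> m1 \<otimes> (W \<otimes> W') \<otimes> n2 \<oplus> k' \<otimes> (W' \<otimes> W) \<oplus> (W' \<otimes> W') \<otimes> (n1' \<otimes> n2)"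
proof -
  have "(m1 \<otimes> W) \<otimes> (m2 \<otimes> W) = m1 \<otimes> (W \<otimes> m2) \<otimes> W" using c by (simp add: m_assoc)
  then have 1: "(m1 \<otimes> W) \<otimes> (m2 \<otimes> W) = m1 \<otimes> m2' \<otimes> (W \<otimes> W)" unfolding W using c by (simp add: m_assoc)
  have 2: "(m1 \<otimes> W) \<otimes> (W' \<otimes> n2) = m1 \<otimes> (W \<otimes> W') \<otimes> n2" using c by (simp add: m_assoc)
  have "(W' \<otimes> n1) \<otimes> (m2 \<otimes> W) = (W' \<otimes> (n1 \<otimes> m2)) \<otimes> W" using c by (simp add: m_assoc)
  then have 3: "(W' \<otimes> n1) \<otimes> (m2 \<otimes> W) = k' \<otimes> (W' \<otimes> W)" unfolding k using c by (simp add: m_assoc)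
  have "(W' \<otimes> n1) \<otimes> (W' \<otimes> n2) = W' \<otimes> (n1 \<otimes> W') \<otimes> n2" using c by (simp add: m_assoc)
  then have 4: "(W' \<otimes> n1) \<otimes> (W' \<otimes> n2) = (W' \<otimes> W') \<otimes> (n1' \<otimes> n2)" unfolding n using c by (simp add: m_assoc)
  have "(m1 \<otimes> W \<oplus> W' \<otimes> n1) \<otimes> (m2 \<otimes> W \<oplus> W' \<otimes> n2) =
      (m1 \<otimes> W) \<otimes> (m2 \<otimes> W) \<oplus> (m1 \<otimes> W) \<otimes> (W' \<otimes> n2) \<oplus> (W' \<otimes> n1) \<otimes> (m2 \<otimes> W) \<oplus> (W' \<otimes> n1) \<otimes> (W' \<otimes> n2)"
    using c by (simp add: l_distr r_distr a_ac)
  then show ?thesis unfolding 1 2 3 4 .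
qed

section \<open>Tensors of degree one and two in the free algebra\<close>

lemma tensor1_support: "{w. tensor1 Y w \<noteq> 0} \<subseteq> range (\<lambda>i. [i])"
proof
  fix w assume "w \<in> {w. tensor1 Y w \<noteq> 0}"
  then obtain i where "w = [i]" by (auto simp: tensor1_def split: list.splits)
  then show "w \<in> range (\<lambda>i. [i])" by simp
qed

lemma tensor1_in_carrier: "tensor1 (Y :: complex^'n::finite) \<in> carrier (free_algebra UNIV)"
  using finite_subset[OF tensor1_support[of Y]] by (simp add: free_algebra_simps)

lemma tensor2_support: "{w. tensor2 B w \<noteq> 0} \<subseteq> range (\<lambda>p. [fst p, snd p])"
proof
  fix w assume "w \<in> {w. tensor2 B w \<noteq> 0}"
  then obtain i j where "w = [i, j]" by (auto simp: tensor2_def split: list.splits)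
  then show "w \<in> range (\<lambda>p. [fst p, snd p])" by (auto intro: rev_image_eqI[of "(i, j)"])
qed

lemma tensor2_in_carrier: "tensor2 (B :: complex^('n::finite \<times> 'n)) \<in> carrier (free_algebra UNIV)"
  using finite_subset[OF tensor2_support[of B]] by (simp add: free_algebra_simps)

lemma letter_eq_tensor1: "letter i = tensor1 (axis i 1)"
  by (rule ext) (auto simp: letter_def tensor1_def axis_def split: list.splits)

lemma eval_tensor1:
  fixes Y :: "complex^'n::finite"
  assumes "word_evaluation A (UNIV :: 'n set) s a"
  shows "word_evaluation.eval_free A s a (tensor1 Y) = (\<Oplus>\<^bsub>A\<^esub>i\<in>UNIV. s (Y $ i) \<otimes>\<^bsub>A\<^esub> a i)"
proof -
  interpret word_evaluation A UNIV s a by fact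
  have "eval_free (tensor1 Y) = (\<Oplus>\<^bsub>A\<^esub>w\<in>range (\<lambda>i. [i]). s (tensor1 Y w) \<otimes>\<^bsub>A\<^esub> eval_word w)"
    by (intro eval_free_superset tensor1_support) auto
  also have "\<dots> = (\<Oplus>\<^bsub>A\<^esub>i\<in>UNIV. s (tensor1 Y [i]) \<otimes>\<^bsub>A\<^esub> eval_word [i])"
    by (rule finsum_reindex) (auto simp: inj_on_def)
  finally show ?thesis by (simp add: tensor1_def eval_word_def)
qed

lemma eval_tensor2:
  fixes B :: "complex^('n::finite \<times> 'n)"
  assumes "word_evaluation A (UNIV :: 'n set) s a"
  shows "word_evaluation.eval_free A s a (tensor2 B) =
    (\<Oplus>\<^bsub>A\<^esub>p\<in>UNIV. s (B $ p) \<otimes>\<^bsub>A\<^esub> (a (fst p) \<otimes>\<^bsub>A\<^esub> a (snd p)))"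
proof -
  interpret word_evaluation A UNIV s a by fact
  have "eval_free (tensor2 B) =
      (\<Oplus>\<^bsub>A\<^esub>w\<in>range (\<lambda>p. [fst p, snd p]). s (tensor2 B w) \<otimes>\<^bsub>A\<^esub> eval_word w)"
    by (intro eval_free_superset tensor2_support) auto
  also have "\<dots> = (\<Oplus>\<^bsub>A\<^esub>p\<in>UNIV. s (tensor2 B [fst p, snd p]) \<otimes>\<^bsub>A\<^esub> eval_word [fst p, snd p])"
    by (rule finsum_reindex) (auto simp: inj_on_def)
  finally show ?thesis by (simp add: tensor2_def eval_word_def)
qed

section \<open>The geometric setting and the shift on \<open>C\<close>\<close>

locale cross_setting =
  fixes R :: "(complex^('n::finite \<times> 'n)) set"
    and E :: "'n proj set" and \<sigma> :: "'n proj \<Rightarrow> 'n proj"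
    and C :: "('n proj \<times> 'n proj) set"
    and Q :: "complex^('n::finite \<times> 'n)" and L L' :: "complex^'n"
  assumes geometric: "geometric_data R E \<sigma>"
    and component: "irreducible_component zariski2 (E \<times> E) C"
    and invariant: "sigma_tilde E \<sigma> ` C = C"
    and symmetric: "Q \<in> symmetric_tensors"
    and central: "central_on R E \<sigma> Q C"
    and Q_nz: "\<exists>(Z, Z')\<in>C. bil Q Z Z' \<noteq> 0"
    and L_nz: "\<exists>(Z, Z')\<in>C. lin L Z * lin L' Z' \<noteq> 0"
begin

abbreviation \<sigma>' where "\<sigma>' \<equiv> inv_into E \<sigma>"
abbreviation \<tau> where "\<tau> \<equiv> map_prod \<sigma> \<sigma>'"
abbreviation \<tau>' where "\<tau>' \<equiv> map_prod \<sigma>' \<sigma>"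

lemma irreducible: "irreducible_in zariski2 C" and C_sub: "C \<subseteq> E \<times> E"
  using component by (auto simp: irreducible_component_def)

lemma C_nonempty: "C \<noteq> {}"
  using irreducible by (simp add: irreducible_in_def)

lemma bij: "bij_betw \<sigma> E E" and regular: "regular_map_on E \<sigma>" "regular_map_on E \<sigma>'"
  using geometric by (auto simp: geometric_data_def variety_automorphism_def)

lemma \<sigma>_simps [simp]:
  assumes "Z \<in> E" shows "\<sigma> Z \<in> E" "\<sigma>' Z \<in> E" "\<sigma> (\<sigma>' Z) = Z" "\<sigma>' (\<sigma> Z) = Z"
  using assms bij_betw_apply[OF bij] bij_betw_apply[OF bij_betw_inv_into[OF bij]]
    bij_betw_inv_into_right[OF bij] bij_betw_inv_into_left[OF bij] by auto

lemma sigma_tilde_eq: "sigma_tilde E \<sigma> = \<tau>" "sigma_tilde_inv E \<sigma> = \<tau>'"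
  by (auto simp: sigma_tilde_def sigma_tilde_inv_def)

lemma in_C: "x \<in> C \<Longrightarrow> fst x \<in> E" "x \<in> C \<Longrightarrow> snd x \<in> E"
  using C_sub by auto

lemma \<tau>_\<tau>': "x \<in> C \<Longrightarrow> \<tau> (\<tau>' x) = x" "x \<in> C \<Longrightarrow> \<tau>' (\<tau> x) = x"
  using in_C by (cases x; force)+

lemma \<tau>_image: "\<tau> ` C = C"
  using invariant by (simp only: sigma_tilde_eq)

lemma \<tau>'_image: "\<tau>' ` C = C"
proof -
  have "\<tau>' ` \<tau> ` C = C" using \<tau>_\<tau>'(2) by (force simp: image_image)
  then show ?thesis unfolding \<tau>_image .
qed

lemmas gen_\<tau>' = generically_vimage[OF continuous_map_regular[OF regular(2,1) C_sub] \<tau>'_image]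
lemmas gen_conj = generically_conj[OF irreducible]

lemma gen_L: "generically C (\<lambda>x. lin L (fst x) \<noteq> 0)"
  using generically_nonzero[OF bihomogeneous_fst[OF homogeneous_lin[of L]], of C] L_nz
  by (force simp: lin_def)

lemma gen_L': "generically C (\<lambda>x. lin L' (snd x) \<noteq> 0)"
  using generically_nonzero[OF bihomogeneous_snd[OF homogeneous_lin[of L']], of C] L_nz
  by (force simp: lin_def)

lemma gen_Q: "generically C (\<lambda>x. bil Q (fst x) (snd x) \<noteq> 0)"
  using generically_nonzero[OF bihomogeneous_bil[of Q], of C] Q_nz
  by (force simp: bil_def)

section \<open>Generators and relations of \<open>C_Q\<close>\<close>

abbreviation "mero \<equiv> mero_repr C"
abbreviation "gens \<equiv> cross_gens C"
abbreviation "rels \<equiv> cross_rels E \<sigma> C Q L L'"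
abbreviation "A \<equiv> presented gens rels"
abbreviation "F \<equiv> free_algebra gens"
abbreviation "cls \<equiv> pclass gens rels"
abbreviation "\<pi> \<equiv> cross_pi L L' Q"

definition ratio :: "complex^'n \<Rightarrow> 'n proj \<times> 'n proj \<Rightarrow> complex" where
  "ratio Y = (\<lambda>(Z, Z'). lin Y Z / lin L Z)"

definition ratio' :: "complex^'n \<Rightarrow> 'n proj \<times> 'n proj \<Rightarrow> complex" where
  "ratio' Y = (\<lambda>(Z, Z'). lin Y Z' / lin L' Z')"

lemma mero_closed [simp]:
  "(\<lambda>_. c) \<in> mero"
  "\<lbrakk>f \<in> mero; g \<in> mero\<rbrakk> \<Longrightarrow> (\<lambda>x. f x + g x) \<in> mero"
  "\<lbrakk>f \<in> mero; g \<in> mero\<rbrakk> \<Longrightarrow> (\<lambda>x. f x * g x) \<in> mero"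
  "f \<in> mero \<Longrightarrow> f \<circ> \<tau> \<in> mero" "f \<in> mero \<Longrightarrow> f \<circ> \<tau>' \<in> mero"
  using mero_repr_const[OF C_nonempty] mero_repr_add[OF irreducible] mero_repr_mult[OF irreducible]
    mero_repr_comp_regular[OF irreducible C_sub regular \<tau>_image]
    mero_repr_comp_regular[OF irreducible C_sub regular(2,1) \<tau>'_image] by auto

lemma pi_mero [simp]: "\<pi> \<in> mero"
proof (rule mero_reprI)
  show "bihomogeneous 1 1 (\<lambda>x. (\<Sum>i\<in>UNIV. L $ i * fst x $ i) * (\<Sum>i\<in>UNIV. L' $ i * snd x $ i))"
    using bihomogeneous_mult[OF bihomogeneous_fst[OF homogeneous_lin[of L]]
        bihomogeneous_snd[OF homogeneous_lin[of L']]] by simp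
  show "bihomogeneous 1 1 (\<lambda>x. \<Sum>i\<in>UNIV. \<Sum>j\<in>UNIV. Q $ (i, j) * fst x $ i * snd x $ j)"
    by (rule bihomogeneous_bil)
qed (use Q_nz C_nonempty in \<open>force simp: cross_pi_def lin_def bil_def\<close>)+

lemma ratio_mero [simp]: "ratio Y \<in> mero"
  by (rule mero_reprI[OF bihomogeneous_fst[OF homogeneous_lin[of Y]] bihomogeneous_fst[OF homogeneous_lin[of L]]])
    (use L_nz C_nonempty in \<open>force simp: ratio_def lin_def\<close>)+

lemma ratio'_mero [simp]: "ratio' Y \<in> mero"
  by (rule mero_reprI[OF bihomogeneous_snd[OF homogeneous_lin[of Y]] bihomogeneous_snd[OF homogeneous_lin[of L']]])
    (use L_nz C_nonempty in \<open>force simp: ratio'_def lin_def\<close>)+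

lemma letters_in_carrier [simp]:
  "f \<in> mero \<Longrightarrow> mero_letter C f \<in> carrier F" "letter Wgen \<in> carrier F" "letter Wgen' \<in> carrier F"
  by (auto intro!: letter_in_carrier simp: cross_gens_def mero_class_in_carrier)

text \<open>Every function letter occurring in a relation must belong to the generating set, so
  closure of the meromorphic functions under sums, products and both shifts enters here.\<close>

lemma rels_closed: "rels \<subseteq> carrier F"
proof -
  interpret F: ring F by (rule free_algebra_ring)
  have a: "p \<oplus>\<^bsub>F\<^esub> q \<in> carrier F" and m: "p \<otimes>\<^bsub>F\<^esub> q \<in> carrier F" and s: "p \<ominus>\<^bsub>F\<^esub> q \<in> carrier F"
    if "p \<in> carrier F" "q \<in> carrier F" for p q using that by simp_all
  show ?thesis
    unfolding cross_rels_def Let_def sigma_tilde_eq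
    by (intro Un_least subsetI; elim CollectE exE conjE insertE emptyE;
        simp only:; intro a m s letters_in_carrier scalar_in_carrier mero_closed pi_mero; assumption)
qed

interpretation A: ring A
  by (rule presented_ring[OF rels_closed])

lemmas cls_hom = pclass_hom[OF rels_closed]
lemmas cls_mult = ring_hom_mult[OF cls_hom]
lemmas cls_add = ring_hom_add[OF cls_hom]
lemmas cls_closed = ring_hom_closed[OF cls_hom]

definition m :: "('n proj \<times> 'n proj \<Rightarrow> complex) \<Rightarrow> ('n cross_letter list \<Rightarrow> complex) set" where
  "m f = cls (mero_letter C f)"
definition W where "W = cls (letter Wgen)"
definition W' where "W' = cls (letter Wgen')"
definition s where "s c = cls (scalar c)"

lemma closed [simp]: "f \<in> mero \<Longrightarrow> m f \<in> carrier A" "W \<in> carrier A" "W' \<in> carrier A" "s c \<in> carrier A"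
  by (simp_all add: m_def W_def W'_def s_def cls_closed)

lemma m_cong: "generically C (\<lambda>x. f x = g x) \<Longrightarrow> m f = m g"
  unfolding m_def using mero_class_cong[OF irreducible] by simp

lemma s_eq_m: "s c = m (\<lambda>_. c)"
proof -
  have "mero_letter C (\<lambda>_. c) \<ominus>\<^bsub>F\<^esub> scalar c \<in> rels"
    unfolding cross_rels_def Let_def by blast
  from pclass_diff_relation[OF rels_closed _ _ this] show ?thesis by (simp add: m_def s_def)
qed

lemma m_add: "\<lbrakk>f \<in> mero; g \<in> mero\<rbrakk> \<Longrightarrow> m f \<oplus>\<^bsub>A\<^esub> m g = m (\<lambda>x. f x + g x)"
proof -
  assume f: "f \<in> mero" and g: "g \<in> mero"
  then have "mero_letter C (\<lambda>x. f x + g x) \<ominus>\<^bsub>F\<^esub> (mero_letter C f \<oplus>\<^bsub>F\<^esub> mero_letter C g) \<in> rels"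
    unfolding cross_rels_def Let_def by blast
  from pclass_diff_relation[OF rels_closed _ _ this] f g show ?thesis
    by (simp add: m_def cls_add ring.ring_simprules(1)[OF free_algebra_ring])
qed

lemma m_mult: "\<lbrakk>f \<in> mero; g \<in> mero\<rbrakk> \<Longrightarrow> m f \<otimes>\<^bsub>A\<^esub> m g = m (\<lambda>x. f x * g x)"
proof -
  assume f: "f \<in> mero" and g: "g \<in> mero"
  then have "mero_letter C (\<lambda>x. f x * g x) \<ominus>\<^bsub>F\<^esub> (mero_letter C f \<otimes>\<^bsub>F\<^esub> mero_letter C g) \<in> rels"
    unfolding cross_rels_def Let_def by blast
  from pclass_diff_relation[OF rels_closed _ _ this] f g show ?thesis
    by (simp add: m_def cls_mult free_algebra_mult_closed)
qed

lemma W_m: "f \<in> mero \<Longrightarrow> W \<otimes>\<^bsub>A\<^esub> m f = m (f \<circ> \<tau>) \<otimes>\<^bsub>A\<^esub> W"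
proof -
  assume f: "f \<in> mero"
  then have "letter Wgen \<otimes>\<^bsub>F\<^esub> mero_letter C f \<ominus>\<^bsub>F\<^esub> mero_letter C (f \<circ> \<tau>) \<otimes>\<^bsub>F\<^esub> letter Wgen \<in> rels"
    unfolding cross_rels_def Let_def sigma_tilde_eq by blast
  from pclass_diff_relation[OF rels_closed _ _ this] f show ?thesis
    by (simp add: m_def W_def cls_mult free_algebra_mult_closed)
qed

lemma W'_m: "f \<in> mero \<Longrightarrow> W' \<otimes>\<^bsub>A\<^esub> m f = m (f \<circ> \<tau>') \<otimes>\<^bsub>A\<^esub> W'"
proof -
  assume f: "f \<in> mero"
  then have "letter Wgen' \<otimes>\<^bsub>F\<^esub> mero_letter C f \<ominus>\<^bsub>F\<^esub> mero_letter C (f \<circ> \<tau>') \<otimes>\<^bsub>F\<^esub> letter Wgen' \<in> rels"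
    unfolding cross_rels_def Let_def sigma_tilde_eq by blast
  from pclass_diff_relation[OF rels_closed _ _ this] f show ?thesis
    by (simp add: m_def W'_def cls_mult free_algebra_mult_closed)
qed

lemma W_W': "W \<otimes>\<^bsub>A\<^esub> W' = m \<pi>"
proof -
  have "letter Wgen \<otimes>\<^bsub>F\<^esub> letter Wgen' \<ominus>\<^bsub>F\<^esub> mero_letter C \<pi> \<in> rels"
    unfolding cross_rels_def Let_def by blast
  from pclass_diff_relation[OF rels_closed _ _ this] show ?thesis
    by (simp add: m_def W_def W'_def cls_mult free_algebra_mult_closed)
qed

lemma W'_W: "W' \<otimes>\<^bsub>A\<^esub> W = m (\<pi> \<circ> \<tau>')"
proof -
  have "letter Wgen' \<otimes>\<^bsub>F\<^esub> letter Wgen \<ominus>\<^bsub>F\<^esub> mero_letter C (\<pi> \<circ> \<tau>') \<in> rels"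
    unfolding cross_rels_def Let_def sigma_tilde_eq by blast
  from pclass_diff_relation[OF rels_closed _ _ this] show ?thesis
    by (simp add: m_def W_def W'_def cls_mult free_algebra_mult_closed)
qed

text \<open>The relation for \<open>W'\<close>, applied to \<open>f \<circ> \<tau>\<close> and read
  backwards. The shifts are inverse to each other on \<open>C\<close> only, so
  \<open>f \<circ> \<tau> \<circ> \<tau>'\<close> is identified with \<open>f\<close> as a class,
  not as a function.\<close>

lemma m_W': "f \<in> mero \<Longrightarrow> m f \<otimes>\<^bsub>A\<^esub> W' = W' \<otimes>\<^bsub>A\<^esub> m (f \<circ> \<tau>)"
proof -
  assume f: "f \<in> mero"
  have "generically C (\<lambda>x. True)" by (rule generically_mono[OF gen_L]) simp
  then have "generically C (\<lambda>x. f x = (f \<circ> \<tau> \<circ> \<tau>') x)"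
    by (rule generically_mono) (simp only: comp_apply \<tau>_\<tau>')
  then have "m f = m (f \<circ> \<tau> \<circ> \<tau>')" by (rule m_cong)
  then show ?thesis using W'_m[of "f \<circ> \<tau>"] f by simp
qed

lemma s_add: "s (c + d) = s c \<oplus>\<^bsub>A\<^esub> s d" and s_mult: "s (c * d) = s c \<otimes>\<^bsub>A\<^esub> s d"
  by (simp_all add: s_eq_m m_add m_mult)

lemma s_one: "s 1 = \<one>\<^bsub>A\<^esub>"
  using ring_hom_one[OF cls_hom] unfolding s_def free_algebra_one .

lemma s_zero: "s 0 = \<zero>\<^bsub>A\<^esub>"
  unfolding s_def using ring_hom_zero[OF cls_hom free_algebra_ring A.ring_axioms]
  by (simp add: free_algebra_simps scalar_def[abs_def])

lemma s_central: "x \<in> carrier A \<Longrightarrow> s c \<otimes>\<^bsub>A\<^esub> x = x \<otimes>\<^bsub>A\<^esub> s c"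
  unfolding carrier_presented s_def by (auto simp: cls_mult[symmetric] scalar_central)

lemma m_sum:
  assumes "finite I" "\<And>i. i \<in> I \<Longrightarrow> f i \<in> mero"
  shows "(\<Oplus>\<^bsub>A\<^esub>i\<in>I. m (f i)) = m (\<lambda>x. \<Sum>i\<in>I. f i x)"
  using assms
proof (induction I rule: finite_induct)
  case empty
  then show ?case using s_zero by (simp add: s_eq_m)
next
  case (insert i I)
  then have "(\<Oplus>\<^bsub>A\<^esub>i\<in>insert i I. m (f i)) = m (f i) \<oplus>\<^bsub>A\<^esub> (\<Oplus>\<^bsub>A\<^esub>i\<in>I. m (f i))"
    by (intro A.finsum_insert) auto
  then show ?case using insert by (simp add: m_add mero_repr_sum[OF irreducible])
qed

section \<open>Images of vectors and of bilinear forms\<close>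

text \<open>This is sqrt 2 times the intended image of \<open>Y\<close>; splitting off the scalar
  keeps it out of the computation with bilinear forms.\<close>

definition rho_vec :: "complex^'n \<Rightarrow> ('n cross_letter list \<Rightarrow> complex) set" where
  "rho_vec Y = m (ratio Y) \<otimes>\<^bsub>A\<^esub> W \<oplus>\<^bsub>A\<^esub> W' \<otimes>\<^bsub>A\<^esub> m (ratio' Y)"

lemma rho_vec_closed [simp]: "rho_vec Y \<in> carrier A"
  by (simp add: rho_vec_def)

text \<open>In the third term moving the functions past \<open>W'\<close> composes them with
  \<tau>', and \<open>W'\<close> times \<open>W\<close> is itself
  \<open>\<pi> \<circ> \<tau>'\<close>, so the whole product is shifted at once.\<close>

lemma rho_vec_mult:
  "rho_vec Y \<otimes>\<^bsub>A\<^esub> rho_vec Y' =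
    m (\<lambda>x. ratio Y x * ratio Y' (\<tau> x)) \<otimes>\<^bsub>A\<^esub> (W \<otimes>\<^bsub>A\<^esub> W)
    \<oplus>\<^bsub>A\<^esub> m (\<lambda>x. ratio Y x * ratio' Y' x * \<pi> x)
    \<oplus>\<^bsub>A\<^esub> m ((\<lambda>x. ratio' Y x * ratio Y' x * \<pi> x) \<circ> \<tau>')
    \<oplus>\<^bsub>A\<^esub> (W' \<otimes>\<^bsub>A\<^esub> W') \<otimes>\<^bsub>A\<^esub> m (\<lambda>x. ratio' Y (\<tau> x) * ratio' Y' x)"
proof -
  have k: "W' \<otimes>\<^bsub>A\<^esub> (m (ratio' Y) \<otimes>\<^bsub>A\<^esub> m (ratio Y')) =
      m ((\<lambda>x. ratio' Y x * ratio Y' x) \<circ> \<tau>') \<otimes>\<^bsub>A\<^esub> W'"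
    by (simp add: m_mult W'_m)
  have "rho_vec Y \<otimes>\<^bsub>A\<^esub> rho_vec Y' =
      m (ratio Y) \<otimes>\<^bsub>A\<^esub> m (ratio Y' \<circ> \<tau>) \<otimes>\<^bsub>A\<^esub> (W \<otimes>\<^bsub>A\<^esub> W)
      \<oplus>\<^bsub>A\<^esub> m (ratio Y) \<otimes>\<^bsub>A\<^esub> (W \<otimes>\<^bsub>A\<^esub> W') \<otimes>\<^bsub>A\<^esub> m (ratio' Y')
      \<oplus>\<^bsub>A\<^esub> m ((\<lambda>x. ratio' Y x * ratio Y' x) \<circ> \<tau>') \<otimes>\<^bsub>A\<^esub> (W' \<otimes>\<^bsub>A\<^esub> W)
      \<oplus>\<^bsub>A\<^esub> (W' \<otimes>\<^bsub>A\<^esub> W') \<otimes>\<^bsub>A\<^esub> (m (ratio' Y \<circ> \<tau>) \<otimes>\<^bsub>A\<^esub> m (ratio' Y'))"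
    unfolding rho_vec_def
    by (rule A.cross_product_expand[OF _ _ _ _ _ _ _ _ _ W_m m_W' k]) simp_all
  also have "m (ratio Y) \<otimes>\<^bsub>A\<^esub> m (ratio Y' \<circ> \<tau>) = m (\<lambda>x. ratio Y x * ratio Y' (\<tau> x))"
    by (simp add: m_mult)
  also have "m (ratio Y) \<otimes>\<^bsub>A\<^esub> (W \<otimes>\<^bsub>A\<^esub> W') \<otimes>\<^bsub>A\<^esub> m (ratio' Y') = m (\<lambda>x. ratio Y x * ratio' Y' x * \<pi> x)"
    by (simp add: W_W' m_mult mult_ac)
  also have "m ((\<lambda>x. ratio' Y x * ratio Y' x) \<circ> \<tau>') \<otimes>\<^bsub>A\<^esub> (W' \<otimes>\<^bsub>A\<^esub> W) =
      m ((\<lambda>x. ratio' Y x * ratio Y' x * \<pi> x) \<circ> \<tau>')"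
    by (simp add: W'_W m_mult) (simp add: comp_def)
  also have "m (ratio' Y \<circ> \<tau>) \<otimes>\<^bsub>A\<^esub> m (ratio' Y') = m (\<lambda>x. ratio' Y (\<tau> x) * ratio' Y' x)"
    by (simp add: m_mult)
  finally show ?thesis .
qed

text \<open>Twice the intended image of \<open>B\<close>, since each tensor factor enters through
  \<open>rho_vec\<close> without its 1 / sqrt 2.\<close>

definition eval_bil :: "complex^('n \<times> 'n) \<Rightarrow> ('n cross_letter list \<Rightarrow> complex) set" where
  "eval_bil B = (\<Oplus>\<^bsub>A\<^esub>p\<in>UNIV. s (B $ p) \<otimes>\<^bsub>A\<^esub> (rho_vec (axis (fst p) 1) \<otimes>\<^bsub>A\<^esub> rho_vec (axis (snd p) 1)))"

lemma lin_axis: "lin (axis i 1) Z = rep_proj Z $ i"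
  by (simp add: lin_def axis_def if_distrib[of "\<lambda>c. c * _"] cong: if_cong)

lemma bil_sum: "bil B Z Z' = (\<Sum>p\<in>UNIV. B $ p * (rep_proj Z $ fst p * rep_proj Z' $ snd p))"
  by (simp add: bil_def sum.cartesian_product UNIV_Times_UNIV[symmetric] split_beta mult.assoc del: UNIV_Times_UNIV)

lemma lin_sum: "lin Y Z = (\<Sum>i\<in>UNIV. Y $ i * lin (axis i 1) Z)"
  by (simp add: lin_axis) (simp add: lin_def)

text \<open>Letters of the tensor algebra are coordinate vectors; by this linearity the formula
  prescribed for all \<open>Y\<close> follows from the images of the letters.\<close>

lemma rho_vec_sum: "(\<Oplus>\<^bsub>A\<^esub>i\<in>UNIV. s (Y $ i) \<otimes>\<^bsub>A\<^esub> rho_vec (axis i 1)) = rho_vec Y"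
proof -
  have cm: "s c \<otimes>\<^bsub>A\<^esub> (m f \<otimes>\<^bsub>A\<^esub> W \<oplus>\<^bsub>A\<^esub> W' \<otimes>\<^bsub>A\<^esub> m g) =
      m (\<lambda>x. c * f x) \<otimes>\<^bsub>A\<^esub> W \<oplus>\<^bsub>A\<^esub> W' \<otimes>\<^bsub>A\<^esub> m (\<lambda>x. c * g x)"
    if "f \<in> mero" "g \<in> mero" for c f g
  proof -
    have "s c \<otimes>\<^bsub>A\<^esub> (W' \<otimes>\<^bsub>A\<^esub> m g) = W' \<otimes>\<^bsub>A\<^esub> (s c \<otimes>\<^bsub>A\<^esub> m g)"
      using that s_central[of W' c] by (simp add: A.m_assoc[symmetric])
    then show ?thesis
      using that by (simp add: A.r_distr A.m_assoc[symmetric]) (simp add: s_eq_m m_mult A.m_assoc)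
  qed
  have "(\<Oplus>\<^bsub>A\<^esub>i\<in>UNIV. s (Y $ i) \<otimes>\<^bsub>A\<^esub> rho_vec (axis i 1)) =
      (\<Oplus>\<^bsub>A\<^esub>i\<in>UNIV. m (\<lambda>x. Y $ i * ratio (axis i 1) x) \<otimes>\<^bsub>A\<^esub> W
        \<oplus>\<^bsub>A\<^esub> W' \<otimes>\<^bsub>A\<^esub> m (\<lambda>x. Y $ i * ratio' (axis i 1) x))"
    unfolding rho_vec_def by (intro A.finsum_cong') (simp_all add: cm)
  also have "\<dots> = m (\<lambda>x. \<Sum>i\<in>UNIV. Y $ i * ratio (axis i 1) x) \<otimes>\<^bsub>A\<^esub> W
        \<oplus>\<^bsub>A\<^esub> W' \<otimes>\<^bsub>A\<^esub> m (\<lambda>x. \<Sum>i\<in>UNIV. Y $ i * ratio' (axis i 1) x)"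
    by (simp add: A.finsum_addf A.finsum_ldistr[symmetric] A.finsum_rdistr[symmetric] m_sum)
  also have "(\<lambda>x. \<Sum>i\<in>UNIV. Y $ i * ratio (axis i 1) x) = ratio Y"
    by (rule ext) (simp add: ratio_def split_beta lin_sum[of Y] sum_divide_distrib)
  also have "(\<lambda>x. \<Sum>i\<in>UNIV. Y $ i * ratio' (axis i 1) x) = ratio' Y"
    by (rule ext) (simp add: ratio'_def split_beta lin_sum[of Y] sum_divide_distrib)
  finally show ?thesis unfolding rho_vec_def .
qed

definition coeff_WW :: "complex^('n \<times> 'n) \<Rightarrow> 'n proj \<times> 'n proj \<Rightarrow> complex" where
  "coeff_WW B = (\<lambda>x. bil B (fst x) (\<sigma> (fst x)) / (lin L (fst x) * lin L (\<sigma> (fst x))))"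

definition coeff_W'W' :: "complex^('n \<times> 'n) \<Rightarrow> 'n proj \<times> 'n proj \<Rightarrow> complex" where
  "coeff_W'W' B = (\<lambda>x. bil B (\<sigma>' (snd x)) (snd x) / (lin L' (\<sigma>' (snd x)) * lin L' (snd x)))"

text \<open>The second summand comes from \<open>W'\<close> times \<open>W\<close>. There the first
  tensor factor is evaluated at the second point, whence the swapped arguments of \<open>B\<close>,
  while \<open>Q\<close> keeps the order given by \<open>\<pi> \<circ> \<tau>'\<close>.\<close>

definition coeff_1 :: "complex^('n \<times> 'n) \<Rightarrow> 'n proj \<times> 'n proj \<Rightarrow> complex" where
  "coeff_1 B = (\<lambda>x. bil B (fst x) (snd x) / bil Q (fst x) (snd x) +
     bil B (\<sigma> (snd x)) (\<sigma>' (fst x)) / bil Q (\<sigma>' (fst x)) (\<sigma> (snd x)))"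

lemma eval_bil_eq:
  "eval_bil B = m (coeff_WW B) \<otimes>\<^bsub>A\<^esub> (W \<otimes>\<^bsub>A\<^esub> W) \<oplus>\<^bsub>A\<^esub> m (coeff_1 B)
    \<oplus>\<^bsub>A\<^esub> (W' \<otimes>\<^bsub>A\<^esub> W') \<otimes>\<^bsub>A\<^esub> m (coeff_W'W' B)"
proof -
  let ?e = "\<lambda>i. axis i 1 :: complex^'n"
  define f1 f2 f3 f4 where
    "f1 p = (\<lambda>x. B $ p * (ratio (?e (fst p)) x * ratio (?e (snd p)) (\<tau> x)))" and
    "f2 p = (\<lambda>x. B $ p * (ratio (?e (fst p)) x * ratio' (?e (snd p)) x * \<pi> x))" and
    "f3 p = (\<lambda>x. B $ p * ((\<lambda>x. ratio' (?e (fst p)) x * ratio (?e (snd p)) x * \<pi> x) \<circ> \<tau>') x)" and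
    "f4 p = (\<lambda>x. B $ p * (ratio' (?e (fst p)) (\<tau> x) * ratio' (?e (snd p)) x))" for p
  have \<tau>: "(\<lambda>x. ratio Y (\<tau> x)) \<in> mero" "(\<lambda>x. ratio' Y (\<tau> x)) \<in> mero" for Y
    using mero_closed(4)[of "ratio Y"] mero_closed(4)[of "ratio' Y"] by (simp_all add: comp_def)
  have f: "f1 p \<in> mero" "f2 p \<in> mero" "f3 p \<in> mero" "f4 p \<in> mero" for p
    unfolding f1_def f2_def f3_def f4_def
    by (intro mero_closed \<tau> ratio_mero ratio'_mero pi_mero)+
  have cm: "s c \<otimes>\<^bsub>A\<^esub> (m f \<otimes>\<^bsub>A\<^esub> (W \<otimes>\<^bsub>A\<^esub> W) \<oplus>\<^bsub>A\<^esub> m g \<oplus>\<^bsub>A\<^esub> m h \<oplus>\<^bsub>A\<^esub> (W' \<otimes>\<^bsub>A\<^esub> W') \<otimes>\<^bsub>A\<^esub> m k) =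
      m (\<lambda>x. c * f x) \<otimes>\<^bsub>A\<^esub> (W \<otimes>\<^bsub>A\<^esub> W) \<oplus>\<^bsub>A\<^esub> m (\<lambda>x. c * g x) \<oplus>\<^bsub>A\<^esub> m (\<lambda>x. c * h x)
        \<oplus>\<^bsub>A\<^esub> (W' \<otimes>\<^bsub>A\<^esub> W') \<otimes>\<^bsub>A\<^esub> m (\<lambda>x. c * k x)"
    if "f \<in> mero" "g \<in> mero" "h \<in> mero" "k \<in> mero" for c f g h k
  proof -
    have sm: "s c \<otimes>\<^bsub>A\<^esub> m f = m (\<lambda>x. c * f x)" if "f \<in> mero" for f
      using that by (simp add: s_eq_m m_mult)
    have "s c \<otimes>\<^bsub>A\<^esub> ((W' \<otimes>\<^bsub>A\<^esub> W') \<otimes>\<^bsub>A\<^esub> m k) = (s c \<otimes>\<^bsub>A\<^esub> (W' \<otimes>\<^bsub>A\<^esub> W')) \<otimes>\<^bsub>A\<^esub> m k"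
      using that by (simp add: A.m_assoc)
    also have "s c \<otimes>\<^bsub>A\<^esub> (W' \<otimes>\<^bsub>A\<^esub> W') = (W' \<otimes>\<^bsub>A\<^esub> W') \<otimes>\<^bsub>A\<^esub> s c" by (rule s_central) simp
    also have "(W' \<otimes>\<^bsub>A\<^esub> W') \<otimes>\<^bsub>A\<^esub> s c \<otimes>\<^bsub>A\<^esub> m k = (W' \<otimes>\<^bsub>A\<^esub> W') \<otimes>\<^bsub>A\<^esub> (s c \<otimes>\<^bsub>A\<^esub> m k)"
      using that by (simp add: A.m_assoc)
    finally have 4: "s c \<otimes>\<^bsub>A\<^esub> ((W' \<otimes>\<^bsub>A\<^esub> W') \<otimes>\<^bsub>A\<^esub> m k) = (W' \<otimes>\<^bsub>A\<^esub> W') \<otimes>\<^bsub>A\<^esub> m (\<lambda>x. c * k x)"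
      using that by (simp add: sm)
    have 1: "s c \<otimes>\<^bsub>A\<^esub> (m f \<otimes>\<^bsub>A\<^esub> (W \<otimes>\<^bsub>A\<^esub> W)) = m (\<lambda>x. c * f x) \<otimes>\<^bsub>A\<^esub> (W \<otimes>\<^bsub>A\<^esub> W)"
      using that by (simp add: sm[symmetric] A.m_assoc)
    show ?thesis using that by (simp add: A.r_distr 1 4 sm)
  qed
  have "eval_bil B = (\<Oplus>\<^bsub>A\<^esub>p\<in>UNIV. m (f1 p) \<otimes>\<^bsub>A\<^esub> (W \<otimes>\<^bsub>A\<^esub> W) \<oplus>\<^bsub>A\<^esub> m (f2 p) \<oplus>\<^bsub>A\<^esub> m (f3 p)
      \<oplus>\<^bsub>A\<^esub> (W' \<otimes>\<^bsub>A\<^esub> W') \<otimes>\<^bsub>A\<^esub> m (f4 p))"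
    unfolding eval_bil_def
  proof (intro A.finsum_cong')
    fix p
    show "s (B $ p) \<otimes>\<^bsub>A\<^esub> (rho_vec (?e (fst p)) \<otimes>\<^bsub>A\<^esub> rho_vec (?e (snd p))) =
      m (f1 p) \<otimes>\<^bsub>A\<^esub> (W \<otimes>\<^bsub>A\<^esub> W) \<oplus>\<^bsub>A\<^esub> m (f2 p) \<oplus>\<^bsub>A\<^esub> m (f3 p) \<oplus>\<^bsub>A\<^esub> (W' \<otimes>\<^bsub>A\<^esub> W') \<otimes>\<^bsub>A\<^esub> m (f4 p)"
      unfolding rho_vec_mult f1_def f2_def f3_def f4_def
      by (intro cm mero_closed \<tau> ratio_mero ratio'_mero pi_mero)
  qed (use f in auto)
  also have "\<dots> = m (\<lambda>x. \<Sum>p\<in>UNIV. f1 p x) \<otimes>\<^bsub>A\<^esub> (W \<otimes>\<^bsub>A\<^esub> W) \<oplus>\<^bsub>A\<^esub> m (\<lambda>x. \<Sum>p\<in>UNIV. f2 p x)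
      \<oplus>\<^bsub>A\<^esub> m (\<lambda>x. \<Sum>p\<in>UNIV. f3 p x) \<oplus>\<^bsub>A\<^esub> (W' \<otimes>\<^bsub>A\<^esub> W') \<otimes>\<^bsub>A\<^esub> m (\<lambda>x. \<Sum>p\<in>UNIV. f4 p x)"
    using f by (simp add: A.finsum_addf A.finsum_ldistr[symmetric] A.finsum_rdistr[symmetric] m_sum)
  also have f1_sum: "(\<lambda>x. \<Sum>p\<in>UNIV. f1 p x) = coeff_WW B"
    by (rule ext) (simp add: f1_def coeff_WW_def ratio_def split_beta lin_axis bil_sum sum_divide_distrib)
  also have f4_sum: "(\<lambda>x. \<Sum>p\<in>UNIV. f4 p x) = coeff_W'W' B"
    by (rule ext) (simp add: f4_def coeff_W'W'_def ratio'_def split_beta lin_axis bil_sum sum_divide_distrib)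
  finally have e: "eval_bil B = m (coeff_WW B) \<otimes>\<^bsub>A\<^esub> (W \<otimes>\<^bsub>A\<^esub> W) \<oplus>\<^bsub>A\<^esub> m (\<lambda>x. \<Sum>p\<in>UNIV. f2 p x)
      \<oplus>\<^bsub>A\<^esub> m (\<lambda>x. \<Sum>p\<in>UNIV. f3 p x) \<oplus>\<^bsub>A\<^esub> (W' \<otimes>\<^bsub>A\<^esub> W') \<otimes>\<^bsub>A\<^esub> m (coeff_W'W' B)" .
  \<comment> \<open>The closed formulas for the outer coefficients involve \<sigma> explicitly; that
    they are meromorphic is read off from the sums of products of shifted ratios.\<close>
  have sums: "(\<lambda>x. \<Sum>p\<in>UNIV. f2 p x) \<in> mero" "(\<lambda>x. \<Sum>p\<in>UNIV. f3 p x) \<in> mero"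
    "coeff_WW B \<in> mero" "coeff_W'W' B \<in> mero"
    unfolding f1_sum[symmetric] f4_sum[symmetric] by (intro mero_repr_sum irreducible f finite)+
  have g: "generically C (\<lambda>x. lin L (fst x) \<noteq> 0 \<and> lin L' (snd x) \<noteq> 0)"
    by (rule gen_conj[OF gen_L gen_L'])
  \<comment> \<open>The numerator of \<pi> cancels the denominators of the ratios, but only where
    \<open>L\<close> and \<open>L'\<close> are nonzero, both at the point and at its image under
    \<tau>'. So this is an equality of classes, whereas the outer sums, where nothing cancels, were
    equal as functions.\<close>
  have "m (\<lambda>x. (\<Sum>p\<in>UNIV. f2 p x) + (\<Sum>p\<in>UNIV. f3 p x)) = m (coeff_1 B)"
  proof (rule m_cong, rule generically_mono[OF gen_conj[OF g gen_\<tau>'[OF g]]])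
    fix x assume *: "(lin L (fst x) \<noteq> 0 \<and> lin L' (snd x) \<noteq> 0) \<and>
      lin L (fst (\<tau>' x)) \<noteq> 0 \<and> lin L' (snd (\<tau>' x)) \<noteq> 0"
    have "(\<Sum>p\<in>UNIV. f2 p x) = bil B (fst x) (snd x) / bil Q (fst x) (snd x)"
      using * by (simp add: f2_def ratio_def ratio'_def cross_pi_def split_beta lin_axis bil_sum[of B] sum_divide_distrib)
    moreover have "(\<Sum>p\<in>UNIV. f3 p x) = bil B (\<sigma> (snd x)) (\<sigma>' (fst x)) / bil Q (\<sigma>' (fst x)) (\<sigma> (snd x))"
      using * by (simp add: f3_def ratio_def ratio'_def cross_pi_def split_beta lin_axis bil_sum[of B] sum_divide_distrib)
    ultimately show "(\<Sum>p\<in>UNIV. f2 p x) + (\<Sum>p\<in>UNIV. f3 p x) = coeff_1 B x"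
      by (simp add: coeff_1_def)
  qed
  then have "m (\<lambda>x. \<Sum>p\<in>UNIV. f2 p x) \<oplus>\<^bsub>A\<^esub> m (\<lambda>x. \<Sum>p\<in>UNIV. f3 p x) = m (coeff_1 B)"
    using sums by (simp add: m_add)
  then show ?thesis unfolding e using sums by (simp add: A.a_assoc)
qed

section \<open>Vanishing on the relations\<close>

lemma Gamma_iff: "(Z, Z') \<in> Gamma R \<longleftrightarrow> Z \<in> E \<and> Z' = \<sigma> Z"
  using geometric by (auto simp: geometric_data_def)

lemma bil_\<sigma>: "\<lbrakk>\<omega> \<in> R; Z \<in> E\<rbrakk> \<Longrightarrow> bil \<omega> Z (\<sigma> Z) = 0"
  using Gamma_iff[of Z "\<sigma> Z"] by (simp add: Gamma_def)

lemma bil_Q_commute: "bil Q Z Z' = bil Q Z' Z"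
  unfolding bil_def using symmetric
  by (subst sum.swap) (simp add: symmetric_tensors_def mult_ac)

lemma m_zero: "m (\<lambda>_. 0) = \<zero>\<^bsub>A\<^esub>"
  using s_zero by (simp add: s_eq_m)

lemma m_zeroI: "generically C (\<lambda>x. f x = 0) \<Longrightarrow> m f = \<zero>\<^bsub>A\<^esub>"
  unfolding m_zero[symmetric] by (rule m_cong)

lemma gen_Q2: "generically C (\<lambda>x. bil Q (fst x) (snd x) \<noteq> 0 \<and> bil Q (\<sigma>' (fst x)) (\<sigma> (snd x)) \<noteq> 0)"
  by (rule generically_mono[OF gen_conj[OF gen_Q gen_\<tau>'[OF gen_Q]]]) simp

lemma eval_bil_relation:
  assumes \<omega>: "\<omega> \<in> R" shows "eval_bil \<omega> = \<zero>\<^bsub>A\<^esub>"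
proof -
  \<comment> \<open>The coefficient is 0 at every point of \<open>C\<close>; \<open>gen_L\<close>
    supplies a nonempty open set on which to say so.\<close>
  have "m (coeff_WW \<omega>) = \<zero>\<^bsub>A\<^esub>"
    by (rule m_zeroI, rule generically_mono[OF gen_L]) (simp add: coeff_WW_def bil_\<sigma>[OF \<omega>] in_C)
  moreover have "bil \<omega> (\<sigma>' Z) Z = 0" if "Z \<in> E" for Z
    using bil_\<sigma>[OF \<omega>, of "\<sigma>' Z"] that by simp
  then have "m (coeff_W'W' \<omega>) = \<zero>\<^bsub>A\<^esub>"
    by (intro m_zeroI, intro generically_mono[OF gen_L]) (simp add: coeff_W'W'_def in_C)
  moreover have "m (coeff_1 \<omega>) = \<zero>\<^bsub>A\<^esub>"
  proof (rule m_zeroI, rule generically_mono[OF gen_Q2])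
    fix x assume "x \<in> C" and nz: "bil Q (fst x) (snd x) \<noteq> 0 \<and> bil Q (\<sigma>' (fst x)) (\<sigma> (snd x)) \<noteq> 0"
    \<comment> \<open>Symmetry turns \<open>Q\<close> at (\<sigma> Z', \<sigma>' Z) into the
      denominator occurring in \<open>coeff_1\<close>, so centrality is the sum of the two fractions
      with denominators cleared.\<close>
    then have "bil \<omega> (fst x) (snd x) * bil Q (\<sigma>' (fst x)) (\<sigma> (snd x)) +
        bil Q (fst x) (snd x) * bil \<omega> (\<sigma> (snd x)) (\<sigma>' (fst x)) = 0"
      using central \<omega> by (force simp: central_on_def bil_Q_commute[of "\<sigma>' _" "\<sigma> _"])
    then show "coeff_1 \<omega> x = 0" using nz by (simp add: coeff_1_def field_simps)
  qed
  ultimately show ?thesis by (simp add: eval_bil_eq)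
qed

text \<open>Compositions of regular maps are avoided: \<open>\<sigma>\<^sup>4 Z \<noteq> Z\<close> says that \<open>\<tau>\<^sup>2 (Z, Z)\<close> lies off the
  closed diagonal.\<close>

lemma generically_not_fixed:
  assumes g: "continuous_map zariski2 zariski g" "\<And>x. x \<in> C \<Longrightarrow> g x \<in> E"
    and ne: "\<exists>Z\<in>g ` C. (\<sigma> ^^ 4) Z \<noteq> Z"
  shows "generically C (\<lambda>x. (\<sigma> ^^ 4) (g x) \<noteq> g x)"
proof -
  have eq: "\<sigma> (\<sigma> Z) \<noteq> \<sigma>' (\<sigma>' Z) \<longleftrightarrow> (\<sigma> ^^ 4) Z \<noteq> Z" if "Z \<in> E" for Z
  proof -
    have "(\<sigma> ^^ 4) Z = \<sigma> (\<sigma> (\<sigma> (\<sigma> Z)))" by (simp add: eval_nat_numeral)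
    then show ?thesis using that by (metis \<sigma>_simps)
  qed
  have "continuous_map (subtopology zariski2 C) zariski2 (\<lambda>x. (g x, g x))"
    using continuous_map_compose[OF g(1) continuous_map_zariski_diag]
    by (intro continuous_map_from_subtopology) (simp add: comp_def)
  then have 1: "continuous_map (subtopology zariski2 C) (subtopology zariski2 (E \<times> E)) (\<lambda>x. (g x, g x))"
    using g(2) by (auto simp: continuous_map_in_subtopology)
  have 2: "continuous_map (subtopology zariski2 (E \<times> E)) (subtopology zariski2 (E \<times> E)) \<tau>"
    using continuous_map_regular[OF regular, of "E \<times> E"] by (auto simp: continuous_map_in_subtopology)
  have "continuous_map (subtopology zariski2 C) (subtopology zariski2 (E \<times> E)) (\<tau> \<circ> (\<tau> \<circ> (\<lambda>x. (g x, g x))))"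
    by (intro continuous_map_compose[OF continuous_map_compose[OF 1 2] 2])
  then have "continuous_map (subtopology zariski2 C) zariski2 (\<tau> \<circ> (\<tau> \<circ> (\<lambda>x. (g x, g x))))"
    by (simp add: continuous_map_in_subtopology)
  from openin_continuous_map_preimage[OF this openin_zariski2_neq]
  have "openin (subtopology zariski2 C) {x \<in> C. \<sigma> (\<sigma> (g x)) \<noteq> \<sigma>' (\<sigma>' (g x))}" by simp
  moreover have "{x \<in> C. \<sigma> (\<sigma> (g x)) \<noteq> \<sigma>' (\<sigma>' (g x))} \<noteq> {}" using ne g(2) eq by blast
  ultimately have "generically C (\<lambda>x. x \<in> {x \<in> C. \<sigma> (\<sigma> (g x)) \<noteq> \<sigma>' (\<sigma>' (g x))})"
    by (rule generically_openin)
  then show ?thesis by (rule generically_mono) (use g(2) eq in blast)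
qed

section \<open>The coefficients of the image of \<open>Q\<close>\<close>

text \<open>Centrality is asked for at a single graph point, because that point need not belong to
  \<open>C\<close>; either of two assumptions will provide it.\<close>

lemma Q_graph_zero:
  assumes Z: "Z \<in> E" and c: "central_on R E \<sigma> Q {(Z, \<sigma> Z)}" and ne: "(\<sigma> ^^ 4) Z \<noteq> Z"
  shows "bil Q Z (\<sigma> Z) = 0"
proof (rule ccontr)
  assume nz: "bil Q Z (\<sigma> Z) \<noteq> 0"
  have "bil \<omega> (\<sigma> (\<sigma> Z)) (\<sigma>' Z) = 0" if \<omega>: "\<omega> \<in> R" for \<omega>
  proof -
    have "bil \<omega> Z (\<sigma> Z) * bil Q (\<sigma> (\<sigma> Z)) (\<sigma>' Z) + bil Q Z (\<sigma> Z) * bil \<omega> (\<sigma> (\<sigma> Z)) (\<sigma>' Z) = 0"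
      using c \<omega> by (simp add: central_on_def)
    then show ?thesis using bil_\<sigma>[OF \<omega> Z] nz by simp
  qed
  then have "(\<sigma> (\<sigma> Z), \<sigma>' Z) \<in> Gamma R" by (simp add: Gamma_def)
  \<comment> \<open>Lying on the graph adds one \<sigma> to the two in the first coordinate; a
    further one undoes the inverse on the left, which gives the fourth power.\<close>
  then have "\<sigma>' Z = \<sigma> (\<sigma> (\<sigma> Z))" using Gamma_iff by blast
  then have "\<sigma> (\<sigma> (\<sigma> (\<sigma> Z))) = Z" using Z by (metis \<sigma>_simps(3))
  then show False using ne by (simp add: eval_nat_numeral)
qed

text \<open>If the two factors agree, \<open>C\<close> is a square whose side is mapped into itself
  by \<sigma> and by its inverse, so the graph points over it lie in \<open>C\<close>. Under the
  other alternative they only have to lie in \<open>E \<times> E\<close>.\<close>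

lemma central_on_graph:
  assumes "fst ` C = snd ` C \<or> central_on R E \<sigma> Q (E \<times> E)"
  shows "Z \<in> fst ` C \<Longrightarrow> central_on R E \<sigma> Q {(Z, \<sigma> Z)}"
    and "Z' \<in> snd ` C \<Longrightarrow> central_on R E \<sigma> Q {(\<sigma>' Z', Z')}"
proof -
  have sub: "central_on R E \<sigma> Q {p}" if "p \<in> D" "central_on R E \<sigma> Q D" for p D
    using that unfolding central_on_def by blast
  have \<tau>: "\<tau> x \<in> C" if "x \<in> C" for x using \<tau>_image that by blast
  have prod: "(Z, Z') \<in> C" if "Z \<in> fst ` C" "Z' \<in> snd ` C" for Z Z'
    using irreducible_component_Times[OF component] that by blast
  show "central_on R E \<sigma> Q {(Z, \<sigma> Z)}" if "Z \<in> fst ` C"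
    using assms
  proof
    assume eq: "fst ` C = snd ` C"
    have "\<sigma> Z \<in> fst ` C" using that \<tau> by force
    then show ?thesis using sub[OF prod central] that eq by simp
  next
    assume "central_on R E \<sigma> Q (E \<times> E)"
    then show ?thesis using that in_C by (intro sub[of _ "E \<times> E"]) auto
  qed
  show "central_on R E \<sigma> Q {(\<sigma>' Z', Z')}" if "Z' \<in> snd ` C"
    using assms
  proof
    assume eq: "fst ` C = snd ` C"
    have "\<sigma>' Z' \<in> snd ` C" using that \<tau> by force
    then show ?thesis using sub[OF prod central] that eq by simp
  next
    assume "central_on R E \<sigma> Q (E \<times> E)"
    then show ?thesis using that in_C by (intro sub[of _ "E \<times> E"]) auto
  qed
qed

text \<open>The coefficient of \<open>W \<otimes> W\<close> depends on the first point alone and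
  that of \<open>W' \<otimes> W'\<close> on the second alone, hence one condition on \<sigma>^4 for
  each factor.\<close>

lemma eval_bil_Q:
  assumes c: "fst ` C = snd ` C \<or> central_on R E \<sigma> Q (E \<times> E)"
    and Z: "\<exists>Z\<in>fst ` C. (\<sigma> ^^ 4) Z \<noteq> Z" and Z': "\<exists>Z'\<in>snd ` C. (\<sigma> ^^ 4) Z' \<noteq> Z'"
  shows "eval_bil Q = s 2"
proof -
  have "m (coeff_WW Q) = \<zero>\<^bsub>A\<^esub>"
  proof (rule m_zeroI, rule generically_mono[OF generically_not_fixed[OF continuous_map_zariski_fst _ Z]])
    fix x assume "x \<in> C" "(\<sigma> ^^ 4) (fst x) \<noteq> fst x"
    then show "coeff_WW Q x = 0"
      using Q_graph_zero[OF _ central_on_graph(1)[OF c]] in_C by (simp add: coeff_WW_def)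
  qed (rule in_C)
  moreover have "m (coeff_W'W' Q) = \<zero>\<^bsub>A\<^esub>"
  proof (rule m_zeroI, rule generically_mono[OF generically_not_fixed[OF continuous_map_zariski_snd _ Z']])
    fix x assume x: "x \<in> C" "(\<sigma> ^^ 4) (snd x) \<noteq> snd x"
    then have E: "snd x \<in> E" by (simp add: in_C)
    \<comment> \<open>This coefficient evaluates \<open>Q\<close> on the graph over the preimage of
      the second point. The fixed points of \<sigma>^4 are stable under \<sigma>, so the preimage is
      moved as well.\<close>
    have "(\<sigma> ^^ 4) (\<sigma>' (snd x)) \<noteq> \<sigma>' (snd x)"
    proof
      assume "(\<sigma> ^^ 4) (\<sigma>' (snd x)) = \<sigma>' (snd x)"
      then have "(\<sigma> ^^ 4) (\<sigma> (\<sigma>' (snd x))) = \<sigma> (\<sigma>' (snd x))" by (simp add: eval_nat_numeral)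
      then show False using x E by simp
    qed
    then show "coeff_W'W' Q x = 0"
      using Q_graph_zero[of "\<sigma>' (snd x)"] central_on_graph(2)[OF c, of "snd x"] x E by (simp add: coeff_W'W'_def)
  qed (rule in_C)
  moreover have "m (coeff_1 Q) = s 2"
    unfolding s_eq_m
    by (rule m_cong, rule generically_mono[OF gen_Q2])
      (simp add: coeff_1_def bil_Q_commute[of "\<sigma> _" "\<sigma>' _"])
  ultimately show ?thesis by (simp add: eval_bil_eq)
qed

section \<open>The homomorphism: existence, uniqueness and the value at \<open>Q\<close>\<close>

text \<open>A tensor of degree two picks up the square of this factor, 1 / 2, which compensates for
  the two middle terms of \<open>Q\<close> contributing 1 each.\<close>

definition root_half :: complex where "root_half = 1 / of_real (sqrt 2)"

lemma root_half: "of_real (sqrt 2) * root_half = 1" "root_half * of_real (sqrt 2) = 1" "root_half * root_half = 1 / 2"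
  by (simp_all add: root_half_def of_real_mult[symmetric] del: of_real_mult)

definition rho_letter :: "'n \<Rightarrow> ('n cross_letter list \<Rightarrow> complex) set" where
  "rho_letter i = s root_half \<otimes>\<^bsub>A\<^esub> rho_vec (axis i 1)"

lemma word_evaluation_rho: "word_evaluation A (UNIV :: 'n set) s rho_letter"
  by unfold_locales (simp_all add: s_add s_mult s_one rho_letter_def, erule s_central)

interpretation ev: word_evaluation A "UNIV :: 'n set" s rho_letter
  by (rule word_evaluation_rho)

lemma eval_tensor1_eq: "ev.eval_free (tensor1 Y) = s root_half \<otimes>\<^bsub>A\<^esub> rho_vec Y"
proof -
  have "ev.eval_free (tensor1 Y) = (\<Oplus>\<^bsub>A\<^esub>i\<in>UNIV. s root_half \<otimes>\<^bsub>A\<^esub> (s (Y $ i) \<otimes>\<^bsub>A\<^esub> rho_vec (axis i 1)))"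
    unfolding eval_tensor1[OF word_evaluation_rho] rho_letter_def
    by (intro A.finsum_cong') (simp_all add: A.m_assoc[symmetric] s_mult[symmetric] mult.commute)
  also have "\<dots> = s root_half \<otimes>\<^bsub>A\<^esub> (\<Oplus>\<^bsub>A\<^esub>i\<in>UNIV. s (Y $ i) \<otimes>\<^bsub>A\<^esub> rho_vec (axis i 1))"
    by (intro A.finsum_rdistr[symmetric]) auto
  finally show ?thesis unfolding rho_vec_sum .
qed

lemma eval_tensor2_eq: "ev.eval_free (tensor2 B) = s (1 / 2) \<otimes>\<^bsub>A\<^esub> eval_bil B"
proof -
  \<comment> \<open>The second \<open>root_half\<close> crosses \<open>x\<close> by centrality and
    joins the first one, which leaves 1 / 2 in front of every summand.\<close>
  have swap: "s c \<otimes>\<^bsub>A\<^esub> ((s root_half \<otimes>\<^bsub>A\<^esub> x) \<otimes>\<^bsub>A\<^esub> (s root_half \<otimes>\<^bsub>A\<^esub> y)) =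
      s (1 / 2) \<otimes>\<^bsub>A\<^esub> (s c \<otimes>\<^bsub>A\<^esub> (x \<otimes>\<^bsub>A\<^esub> y))" if "x \<in> carrier A" "y \<in> carrier A" for c x y
  proof -
    have "(s root_half \<otimes>\<^bsub>A\<^esub> x) \<otimes>\<^bsub>A\<^esub> (s root_half \<otimes>\<^bsub>A\<^esub> y) = s root_half \<otimes>\<^bsub>A\<^esub> (x \<otimes>\<^bsub>A\<^esub> s root_half) \<otimes>\<^bsub>A\<^esub> y"
      using that by (simp add: A.m_assoc)
    also have "x \<otimes>\<^bsub>A\<^esub> s root_half = s root_half \<otimes>\<^bsub>A\<^esub> x" using that by (simp add: s_central)
    also have "s root_half \<otimes>\<^bsub>A\<^esub> (s root_half \<otimes>\<^bsub>A\<^esub> x) \<otimes>\<^bsub>A\<^esub> y = s (root_half * root_half) \<otimes>\<^bsub>A\<^esub> (x \<otimes>\<^bsub>A\<^esub> y)"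
      using that by (simp add: A.m_assoc s_mult)
    finally show ?thesis
      using that by (simp add: root_half A.m_assoc[symmetric] s_mult[symmetric] mult.commute)
  qed
  have "ev.eval_free (tensor2 B) = (\<Oplus>\<^bsub>A\<^esub>p\<in>UNIV. s (1 / 2) \<otimes>\<^bsub>A\<^esub>
      (s (B $ p) \<otimes>\<^bsub>A\<^esub> (rho_vec (axis (fst p) 1) \<otimes>\<^bsub>A\<^esub> rho_vec (axis (snd p) 1))))"
    unfolding eval_tensor2[OF word_evaluation_rho] rho_letter_def
    by (intro A.finsum_cong') (auto simp: swap)
  also have "\<dots> = s (1 / 2) \<otimes>\<^bsub>A\<^esub> eval_bil B"
    unfolding eval_bil_def by (intro A.finsum_rdistr[symmetric]) auto
  finally show ?thesis .
qed

lemma cross_homs_iff: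
  "\<rho> \<in> cross_homs R E \<sigma> C Q L L' \<longleftrightarrow> \<rho> \<in> algebra_homs UNIV (tensor2 ` R) gens rels \<and>
    (\<forall>Y. s (of_real (sqrt 2)) \<otimes>\<^bsub>A\<^esub> \<rho> (quad_class R (tensor1 Y)) = rho_vec Y)"
  by (simp add: cross_homs_def Let_def s_def rho_vec_def m_def W_def W'_def ratio_def ratio'_def)

lemma relations_closed: "tensor2 ` R \<subseteq> carrier (free_algebra UNIV)"
  using tensor2_in_carrier by blast

text \<open>The prescribed formula fixes sqrt 2 times the image of a letter; multiplying by
  \<open>root_half\<close> recovers the image itself, and images of letters and scalars determine
  the homomorphism.\<close>

lemma cross_homs_eval:
  assumes \<rho>: "\<rho> \<in> cross_homs R E \<sigma> C Q L L'" and p: "p \<in> carrier (free_algebra UNIV)"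
  shows "\<rho> (quad_class R p) = ev.eval_free p"
proof -
  have hom: "\<rho> \<in> ring_hom (quadratic_algebra R) A" and scal: "\<And>c. \<rho> (quad_class R (scalar c)) = s c"
    using \<rho> by (auto simp: cross_homs_iff algebra_homs_def s_def)
  have hom': "\<rho> \<circ> quad_class R \<in> ring_hom (free_algebra UNIV) A"
    by (rule ring_hom_trans[OF pclass_hom[OF relations_closed] hom])
  have "(\<rho> \<circ> quad_class R) (letter i) = ev.eval_free (letter i)" for i
  proof -
    let ?y = "\<rho> (quad_class R (tensor1 (axis i 1)))"
    have y: "?y \<in> carrier A"
      using ring_hom_closed[OF hom'] tensor1_in_carrier by auto
    have "?y = s (root_half * of_real (sqrt 2)) \<otimes>\<^bsub>A\<^esub> ?y" using y by (simp add: root_half s_one)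
    also have "\<dots> = s root_half \<otimes>\<^bsub>A\<^esub> (s (of_real (sqrt 2)) \<otimes>\<^bsub>A\<^esub> ?y)"
      using y by (simp add: s_mult A.m_assoc)
    also have "\<dots> = s root_half \<otimes>\<^bsub>A\<^esub> rho_vec (axis i 1)" using \<rho> by (simp add: cross_homs_iff)
    finally show ?thesis by (simp add: letter_eq_tensor1 eval_tensor1_eq)
  qed
  then have "(\<rho> \<circ> quad_class R) p = ev.eval_free p"
    by (intro free_algebra_hom_eqI[OF hom' ev.eval_free_hom A.ring_axioms _ _ p]) (simp_all add: scal)
  then show ?thesis by simp
qed

text \<open>Evaluation sends a relation to half of its \<open>eval_bil\<close>, which is zero, so it
  descends to the quotient. Conversely the values on the carrier are forced, and extensionality
  fixes the remaining ones.\<close>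

lemma ex1_cross_hom: "\<exists>!\<rho>. \<rho> \<in> cross_homs R E \<sigma> C Q L L'"
proof (rule ex_ex1I)
  have "ev.eval_free r = \<zero>\<^bsub>A\<^esub>" if "r \<in> tensor2 ` R" for r
    using that by (auto simp: eval_tensor2_eq eval_bil_relation)
  from presented_lift[OF relations_closed A.ring_axioms ev.eval_free_hom this]
  obtain k where k: "k \<in> ring_hom (quadratic_algebra R) A" "k \<in> extensional (carrier (quadratic_algebra R))"
    and ev: "\<And>p. p \<in> carrier (free_algebra UNIV) \<Longrightarrow> k (quad_class R p) = ev.eval_free p" by blast
  have "s (of_real (sqrt 2)) \<otimes>\<^bsub>A\<^esub> (s root_half \<otimes>\<^bsub>A\<^esub> rho_vec Y) = rho_vec Y" for Y
    by (simp add: A.m_assoc[symmetric] s_mult[symmetric] root_half s_one)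
  then have "k \<in> cross_homs R E \<sigma> C Q L L'"
    using k by (simp add: cross_homs_iff algebra_homs_def ev tensor1_in_carrier eval_tensor1_eq s_def[symmetric])
  then show "\<exists>\<rho>. \<rho> \<in> cross_homs R E \<sigma> C Q L L'" by blast
next
  fix \<rho> \<rho>' assume \<rho>: "\<rho> \<in> cross_homs R E \<sigma> C Q L L'" "\<rho>' \<in> cross_homs R E \<sigma> C Q L L'"
  show "\<rho> = \<rho>'"
  proof (rule extensionalityI)
    show "\<rho> \<in> extensional (carrier (quadratic_algebra R))" "\<rho>' \<in> extensional (carrier (quadratic_algebra R))"
      using \<rho> by (auto simp: cross_homs_iff algebra_homs_def)
    fix x assume "x \<in> carrier (quadratic_algebra R)"
    then show "\<rho> x = \<rho>' x"
      unfolding carrier_presented using cross_homs_eval[OF \<rho>(1)] cross_homs_eval[OF \<rho>(2)] by auto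
  qed
qed

lemma cross_hom_Q:
  assumes "\<rho> \<in> cross_homs R E \<sigma> C Q L L'"
    and "fst ` C = snd ` C \<or> central_on R E \<sigma> Q (E \<times> E)"
    and "\<exists>Z\<in>fst ` C. (\<sigma> ^^ 4) Z \<noteq> Z" "\<exists>Z'\<in>snd ` C. (\<sigma> ^^ 4) Z' \<noteq> Z'"
  shows "\<rho> (quad_class R (tensor2 Q)) = \<one>\<^bsub>A\<^esub>"
  unfolding cross_homs_eval[OF assms(1) tensor2_in_carrier] eval_tensor2_eq eval_bil_Q[OF assms(2-4)]
  by (simp add: s_mult[symmetric] s_one)

end

theorem lemma7:
  fixes R :: "(complex^('n::finite \<times> 'n)) set"
    and E :: "'n proj set" and \<sigma> :: "'n proj \<Rightarrow> 'n proj"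
    and C :: "('n proj \<times> 'n proj) set"
    and Q :: "complex^('n::finite \<times> 'n)" and L L' :: "complex^'n"
  assumes "vec.subspace R"
    and "geometric_data R E \<sigma>"
    and "irreducible_component zariski2 (E \<times> E) C"
    and "sigma_tilde E \<sigma> ` C = C"
    and "Q \<in> symmetric_tensors"
    and "central_on R E \<sigma> Q C"
    and "\<exists>(Z, Z')\<in>C. bil Q Z Z' \<noteq> 0"
    and "\<exists>(Z, Z')\<in>C. lin L Z * lin L' Z' \<noteq> 0"
  shows "(\<exists>!\<rho>. \<rho> \<in> cross_homs R E \<sigma> C Q L L') \<and>
    ((fst ` C = snd ` C \<or> central_on R E \<sigma> Q (E \<times> E)) \<and>
     (\<exists>Z\<in>fst ` C. (\<sigma> ^^ 4) Z \<noteq> Z) \<and> (\<exists>Z'\<in>snd ` C. (\<sigma> ^^ 4) Z' \<noteq> Z') \<longrightarrow>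
     (\<forall>\<rho>\<in>cross_homs R E \<sigma> C Q L L'.
        \<rho> (quad_class R (tensor2 Q)) =
        \<one>\<^bsub>presented (cross_gens C) (cross_rels E \<sigma> C Q L L')\<^esub>))"
proof -
  interpret cross_setting R E \<sigma> C Q L L'
    by (intro cross_setting.intro assms(2-8))
  show ?thesis using ex1_cross_hom cross_hom_Q by blast
qed

end
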